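(* Consider the randomly switched system $\dot x = f_\sigma(x)$, $x(0)=x_0$, $t\ge 0$. Suppose that there exist continuously differentiable functions $V_p:\mathbb{R}^n\to\mathbb{R}_{\ge 0}$, $p\in\mathcal{P}$, functions $\alpha_1,\alpha_2\in\mathcal{K}_\infty$, and real numbers $\widetilde\lambda,\overline\lambda,\lambda_\circ>0$, $\mu>1$, such that (i) $\alpha_1(\|x\|)\le V_p(x)\le \alpha_2(\|x\|)$ for all $x\in\mathbb{R}^n$ and all $p\in\mathcal{P}$; (ii) $\frac{\partial V_p}{\partial x}(x)f_p(x)\le -\lambda_\circ V_p(x)$ for all $x\in\mathbb{R}^n$ and all $p\in\mathcal{P}$; (iii) $V_{p_1}(x)\le \mu V_{p_2}(x)$ for all $x\in\mathbb{R}^n$ and all $p_1,p_2\in\mathcal{P}$; (iv) there exists $M\in\mathbb{N}\cup\{0\}$ such that for all $k\ge M$ and all $t\ge 0$, $\mathsf{P}(N_\sigma(t)=k)\le \dfrac{(\overline\lambda t)^k e^{-\widetilde\lambda t}}{k!}$; (v) $\mu<(\lambda_\circ+\widetilde\lambda)/\overline\lambda$. If $\alpha_1$ is convex, then the system is globally asymptotically stable in the mean. Without convexity of $\alpha_1$, the same property holds with $\alpha_1(\|x(t)\|)$ replacing $\|x(t)\|$ everywhere, i.e.: for every $\varepsilon>0$ there is $\widetilde\delta>0$ such that $\|x_0\|<\widetilde\delta$ implies $\sup_{t\ge0}\mathsf{E}[\alpha_1(\|x(t)\|)]<\varepsilon$; and for all $r,\varepsilon'>0$ there is $\widetilde T\ge0$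 such that $\|x_0\|<r$ implies $\sup_{t\ge\widetilde T}\mathsf{E}[\alpha_1(\|x(t)\|)]<\varepsilon'$.
   Context: $\|\cdot\|$ is the Euclidean norm, $\mathbb{R}_{\ge 0}=[0,\infty[$, $\mathbb{N}=\{1,2,\ldots\}$, and $0^0=1$. A continuous function $\alpha:\mathbb{R}_{\ge0}\to\mathbb{R}_{\ge0}$ is of class $\mathcal{K}$ if it is strictly increasing with $\alpha(0)=0$, and of class $\mathcal{K}_\infty$ if in addition $\alpha(r)\to\infty$ as $r\to\infty$. Setting: $\mathcal{P}=\{1,\ldots,\mathrm{N}\}$ is a finite index set; for each $p\in\mathcal{P}$, $f_p:\mathbb{R}^n\to\mathbb{R}^n$ is locally Lipschitz with $f_p(0)=0$. For every compact $K\subset\mathbb{R}_{\ge0}\times\mathbb{R}^n$ there is an integrable function $m_K$ with $\sup_{p\in\mathcal{P}}\|f_p(x)\|\le m_K(t)$ for all $(t,x)\in K$. $(\Omega,\mathfrak{F},(\mathfrak{F}_t)_{t\ge0},\mathsf{P})$ is a complete filtered probability space with expectation $\mathsf{E}$, and $(\mathfrak{F}_t)$ is the natural filtration (satisfying the usual conditions) generated by a càdlàg random process $\sigma$ taking values in $\mathcal{P}$ (the switching signal). The randomly switched system is $\dot x(t)=f_{\sigma(t)}(x(t))$, $x(0)=x_0$, with $x_0\in\mathbb{R}^n$ deterministic and no jumps of $x$ at the switching instants (the discontinuity times of $\sigma$). $x(\cdot)$ denotes its unique solution in the sense of Carathéodory (its existence on all of $[0,\infty[$ is a consequence of the hypotheses,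 not an additional assumption). $N_\sigma(t)$ is the number of switches of $\sigma$ on the interval $]0,t]$. The system is globally asymptotically stable in the mean if both of the following hold, for all initial conditions $x_0$ with corresponding solution $x(\cdot)$: (SM1) for every $\varepsilon>0$ there is $\widetilde\delta>0$ such that $\|x_0\|<\widetilde\delta$ implies $\sup_{t\ge0}\mathsf{E}[\|x(t)\|]<\varepsilon$; (SM2) for all $r,\varepsilon'>0$ there is $\widetilde T\ge0$ such that $\|x_0\|<r$ implies $\sup_{t\ge\widetilde T}\mathsf{E}[\|x(t)\|]<\varepsilon'$. *)

theory Defs
  imports "HOL-Probability.Probability"
begin

definition class_K :: "(real \<Rightarrow> real) \<Rightarrow> bool" where
  "class_K \<alpha> \<longleftrightarrow> continuous_on {0..} \<alpha> \<and> \<alpha> ` {0..} \<subseteq> {0..} \<and> strict_mono_on {0..} \<alpha> \<and> \<alpha> 0 = 0"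

definition class_K_inf :: "(real \<Rightarrow> real) \<Rightarrow> bool" where
  "class_K_inf \<alpha> \<longleftrightarrow> class_K \<alpha> \<and> filterlim \<alpha> at_top at_top"

definition continuously_differentiable ::
    "('a::real_normed_vector \<Rightarrow> 'b::real_normed_vector) \<Rightarrow> bool" where
  "continuously_differentiable g \<longleftrightarrow>
     (\<exists>g' :: 'a \<Rightarrow> 'a \<Rightarrow>\<^sub>L 'b. (\<forall>x. (g has_derivative blinfun_apply (g' x)) (at x)) \<and>
        continuous_on UNIV g')"

text \<open>Paths are functions on all of \<^typ>\<open>real\<close>; only their values on \<open>[0,\<infinity>[\<close> matter.
  The switching signal takes values in \<^typ>\<open>nat\<close>, whose topology is discrete.\<close>

definition cadlag :: "(real \<Rightarrow> 'b::topological_space) \<Rightarrow> bool" where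
  "cadlag s \<longleftrightarrow> (\<forall>t\<ge>0. (s \<longlongrightarrow> s t) (at_right t)) \<and> (\<forall>t>0. \<exists>l. (s \<longlongrightarrow> l) (at_left t))"

text \<open>For a cadlag path in a discrete space the set below is finite, so \<^const>\<open>card\<close>
  really counts the switches.\<close>

definition num_switches :: "(real \<Rightarrow> 'b::topological_space) \<Rightarrow> real \<Rightarrow> nat" where
  "num_switches s t = card {u \<in> {0<..t}. \<not> isCont s u}"

text \<open>The usual augmentation of the natural filtration: null sets are added, and the result is made
  right-continuous. A natural filtration that already satisfies the usual conditions is left
  unchanged by this.\<close>

definition natural_filtration_usual ::
    "'a measure \<Rightarrow> 'b measure \<Rightarrow> (real \<Rightarrow> 'a \<Rightarrow> 'b) \<Rightarrow> real \<Rightarrow> 'a measure" where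
  "natural_filtration_usual M E \<sigma> t = sigma (space M)
     (\<Inter>s\<in>{t<..}. sigma_sets (space M)
        ({\<sigma> u -` A \<inter> space M | u A. 0 \<le> u \<and> u \<le> s \<and> A \<in> sets E} \<union> null_sets M))"

definition absolutely_continuous_interval ::
    "real \<Rightarrow> real \<Rightarrow> (real \<Rightarrow> 'b::real_normed_vector) \<Rightarrow> bool" where
  "absolutely_continuous_interval a b g \<longleftrightarrow>
     (\<forall>\<epsilon>>0. \<exists>\<delta>>0. \<forall>(n::nat) u v.
        (\<forall>i<n. a \<le> u i \<and> u i \<le> v i \<and> v i \<le> b) \<longrightarrow>
        disjoint_family_on (\<lambda>i. {u i<..<v i}) {..<n} \<longrightarrow>
        (\<Sum>i<n. v i - u i) < \<delta> \<longrightarrow>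
        (\<Sum>i<n. norm (g (v i) - g (u i))) < \<epsilon>)"

definition caratheodory_solution ::
    "('p \<Rightarrow> 'b::real_normed_vector \<Rightarrow> 'b) \<Rightarrow> (real \<Rightarrow> 'p) \<Rightarrow> 'b \<Rightarrow> (real \<Rightarrow> 'b) \<Rightarrow> bool" where
  "caratheodory_solution f s x\<^sub>0 x \<longleftrightarrow>
     x 0 = x\<^sub>0 \<and>
     (\<forall>T\<ge>0. absolutely_continuous_interval 0 T x) \<and>
     (AE t in lborel. 0 < t \<longrightarrow> (x has_vector_derivative f (s t) (x t)) (at t))"

text \<open>\<open>X x\<^sub>0 t \<omega>\<close> is the state at time \<open>t\<close>, along the sample \<open>\<omega>\<close>, of the solution that starts at
  \<open>x\<^sub>0\<close>. The equivalence says that this solution exists on \<open>[0,\<infinity>[\<close> and is unique there.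
  The states are required to be random variables so that their expectations make sense.\<close>

definition solution_process ::
    "'a measure \<Rightarrow> ('p \<Rightarrow> 'b::real_normed_vector \<Rightarrow> 'b) \<Rightarrow> (real \<Rightarrow> 'a \<Rightarrow> 'p) \<Rightarrow>
      ('b \<Rightarrow> real \<Rightarrow> 'a \<Rightarrow> 'b) \<Rightarrow> bool" where
  "solution_process M f \<sigma> X \<longleftrightarrow>
     (\<forall>x\<^sub>0. \<forall>\<omega>\<in>space M. \<forall>y.
        caratheodory_solution f (\<lambda>t. \<sigma> t \<omega>) x\<^sub>0 y \<longleftrightarrow> (\<forall>t\<ge>0. y t = X x\<^sub>0 t \<omega>)) \<and>
     (\<forall>x\<^sub>0. \<forall>t\<ge>0. X x\<^sub>0 t \<in> borel_measurable M)"

text \<open>Expectations are taken as \<^typ>\<open>ennreal\<close>-valued integrals, so that an expectation or a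
  supremum below a real bound is genuinely finite (the Bochner integral of a non-integrable function
  would be \<open>0\<close>).\<close>

definition gas_in_mean_of ::
    "(real \<Rightarrow> real) \<Rightarrow> 'a measure \<Rightarrow> ('b::real_normed_vector \<Rightarrow> real \<Rightarrow> 'a \<Rightarrow> 'b) \<Rightarrow> bool" where
  "gas_in_mean_of \<phi> M X \<longleftrightarrow>
     (\<forall>\<epsilon>>0. \<exists>\<delta>>0. \<forall>x\<^sub>0. norm x\<^sub>0 < \<delta> \<longrightarrow>
        (SUP t\<in>{0..}. \<integral>\<^sup>+\<omega>. ennreal (\<phi> (norm (X x\<^sub>0 t \<omega>))) \<partial>M) < ennreal \<epsilon>) \<and>
     (\<forall>r>0. \<forall>\<epsilon>>0. \<exists>T\<ge>0. \<forall>x\<^sub>0. norm x\<^sub>0 < r \<longrightarrow>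
        (SUP t\<in>{T..}. \<integral>\<^sup>+\<omega>. ennreal (\<phi> (norm (X x\<^sub>0 t \<omega>))) \<partial>M) < ennreal \<epsilon>)"

definition gas_in_mean ::
    "'a measure \<Rightarrow> ('b::real_normed_vector \<Rightarrow> real \<Rightarrow> 'a \<Rightarrow> 'b) \<Rightarrow> bool" where
  "gas_in_mean M X \<longleftrightarrow> gas_in_mean_of (\<lambda>r. r) M X"

end

theory Submission
  imports Defs
begin

text \<open>
  Along a solution, the active Lyapunov function decays at rate \<open>lam_o\<close> between switches and is
  multiplied by at most \<open>\<mu>\<close> at each switch (\<open>multiple_lyapunov_bound\<close>), hence
  \<open>\<alpha>\<^sub>1 (norm (x t)) \<le> \<mu> ^ n t * exp (- lam_o * t) * \<alpha>\<^sub>2 (norm x\<^sub>0)\<close>, where \<open>n t\<close> counts the switches up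
  to \<open>t\<close>. By the hypothesis on the law of \<open>n t\<close>, the expectation of \<open>\<mu> ^ n t\<close> is at most a constant
  plus \<open>exp ((\<mu> * lam_bar - lam_tilde) * t)\<close> (\<open>nn_integral_power_le\<close>). The condition on \<open>\<mu>\<close> says
  exactly that \<open>lam_o + lam_tilde - \<mu> * lam_bar\<close> is positive, so the mean of \<open>\<alpha>\<^sub>1 (norm (x t))\<close> decays
  exponentially, with a factor \<open>\<alpha>\<^sub>2 (norm x\<^sub>0)\<close> that is small for small and bounded for bounded initial
  states. Both stability properties follow (\<open>gas_in_mean_of_exponential_bound\<close>). If \<open>\<alpha>\<^sub>1\<close> is convex,
  it dominates a linear function away from \<open>0\<close>, and the statement for \<open>\<alpha>\<^sub>1\<close> carries over to the norm
  itself (\<open>gas_in_mean_of_convex_imp_gas_in_mean\<close>).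

  The larger part of the work is the solution process (\<open>solution_process_exists\<close>): global existence,
  uniqueness in the sense of Caratheodory, and measurability. The vector fields are first truncated to
  bounded, globally Lipschitz ones, for which Picard iteration converges on the whole half line and
  produces jointly measurable solutions (\<open>picard_solution\<close>). The Lyapunov functions also control the
  truncated systems, which confines their solutions, on each time interval and for each sample point,
  to a ball that does not depend on the truncation. So the truncated solutions are eventually constant
  in the truncation radius, and their limit solves the original system. Uniqueness
  (\<open>caratheodory_unique\<close>) rests on the fact that an absolutely continuous function with an almost
  everywhere bounded derivative obeys the corresponding increment bound
  (\<open>absolutely_continuous_interval_bound\<close>). The expectation of \<open>\<mu> ^ n t\<close> makes sense because \<open>n t\<close> is
  measurable (\<open>measurable_num_switches\<close>).
\<close>

section \<open>Absolutely continuous functions and uniqueness of Caratheodory solutions\<close>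

lemma absolutely_continuous_intervalE:
  fixes g :: "real \<Rightarrow> 'b::real_normed_vector"
  assumes "absolutely_continuous_interval a b g" and "e > 0"
  obtains \<delta> where "\<delta> > 0"
    "\<And>(n::nat) u v. (\<forall>i<n. a \<le> u i \<and> u i \<le> v i \<and> v i \<le> b) \<Longrightarrow>
        disjoint_family_on (\<lambda>i. {u i<..<v i}) {..<n} \<Longrightarrow>
        (\<Sum>i<n. v i - u i) < \<delta> \<Longrightarrow> (\<Sum>i<n. norm (g (v i) - g (u i))) < e"
proof -
  obtain \<delta> where \<delta>: "\<delta> > 0 \<and> (\<forall>(n::nat) u v.
        (\<forall>i<n. a \<le> u i \<and> u i \<le> v i \<and> v i \<le> b) \<longrightarrow>
        disjoint_family_on (\<lambda>i. {u i<..<v i}) {..<n} \<longrightarrow>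
        (\<Sum>i<n. v i - u i) < \<delta> \<longrightarrow> (\<Sum>i<n. norm (g (v i) - g (u i))) < e)"
    using assms(1)[unfolded absolutely_continuous_interval_def, THEN spec, THEN mp, OF assms(2)]
    by (elim exE)
  show thesis
    by (rule that[OF \<delta>[THEN conjunct1]
          \<delta>[THEN conjunct2, THEN spec, THEN spec, THEN spec, THEN mp, THEN mp, THEN mp]])
qed

lemma absolutely_continuous_intervalI:
  fixes g :: "real \<Rightarrow> 'b::real_normed_vector"
  assumes "\<And>e. e > 0 \<Longrightarrow> \<exists>\<delta>>0. \<forall>(n::nat) u v.
        (\<forall>i<n. a \<le> u i \<and> u i \<le> v i \<and> v i \<le> b) \<longrightarrow>
        disjoint_family_on (\<lambda>i. {u i<..<v i}) {..<n} \<longrightarrow>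
        (\<Sum>i<n. v i - u i) < \<delta> \<longrightarrow> (\<Sum>i<n. norm (g (v i) - g (u i))) < e"
  shows "absolutely_continuous_interval a b g"
  unfolding absolutely_continuous_interval_def by (intro allI impI assms)

text \<open>The pointwise bound on the derivative gives the increment bound, up to a small error, on every
  short interval around a point where the derivative exists; the exceptional points form a null set.
  Cousin's lemma supplies a tagged division of \<open>[a, b]\<close> into such short intervals, together with
  intervals tagged at exceptional points that all lie in an open set of small measure; absolute
  continuity makes the total increment over the latter negligible.\<close>

lemma absolutely_continuous_interval_bound:
  fixes g :: "real \<Rightarrow> 'b::real_normed_vector"
  assumes ac: "absolutely_continuous_interval a b g" and ab: "a \<le> b"
    and der: "AE t in lborel. a < t \<and> t < b \<longrightarrow>
      (\<exists>d. (g has_vector_derivative d) (at t) \<and> norm d \<le> C)"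
    and C: "0 \<le> C"
  shows "norm (g b - g a) \<le> C * (b - a)"
proof (rule field_le_epsilon)
  fix e0 :: real assume e0: "e0 > 0"
  define e where "e = e0 / (2 * (b - a + 1))"
  have e: "e > 0" using e0 ab by (simp add: e_def)
  have e_le: "e * (b - a) \<le> e0 / 2" using e0 ab by (simp add: e_def field_simps)
  obtain \<delta> where \<delta>: "\<delta> > 0" and
    ac': "\<And>(n::nat) u v. (\<forall>i<n. a \<le> u i \<and> u i \<le> v i \<and> v i \<le> b) \<Longrightarrow>
        disjoint_family_on (\<lambda>i. {u i<..<v i}) {..<n} \<Longrightarrow>
        (\<Sum>i<n. v i - u i) < \<delta> \<Longrightarrow> (\<Sum>i<n. norm (g (v i) - g (u i))) < e0 / 2"
    by (rule absolutely_continuous_intervalE[OF ac half_gt_zero[OF e0]]) (rule that)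
  obtain Z where Z: "Z \<in> null_sets lborel"
    and Z': "\<And>t. t \<notin> Z \<Longrightarrow> a < t \<Longrightarrow> t < b \<Longrightarrow> 
      \<exists>d. (g has_vector_derivative d) (at t) \<and> norm d \<le> C"
    using der by (auto elim!: AE_E3)
  \<comment> \<open>The end points are counted as exceptional because nothing is assumed there.\<close>
  define E where "E = Z \<union> {a, b}"
  have E: "E \<in> null_sets lborel"
    unfolding E_def using null_sets.Un[OF Z finite_imp_null_set_lborel[of "{a, b}"]] by simp
  obtain U where U: "open U" "E \<subseteq> U" "emeasure lborel (U - E) < ennreal \<delta>"
    using outer_regular_lborel[of E \<delta>] null_setsD2[OF E] \<delta> by (metis sets_lborel)
  have U': "emeasure lborel U < ennreal \<delta>"
    using U emeasure_Diff_null_set[OF E, of U] by (simp add: borel_open)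
  have loc: "\<exists>d>0. \<forall>u v. u \<le> t \<and> t \<le> v \<and> u \<in> ball t d \<and> v \<in> ball t d \<longrightarrow>
      norm (g v - g u) \<le> (C + e) * (v - u)" if t: "t \<notin> E" "a \<le> t" "t \<le> b" for t
  proof -
    have "t \<notin> Z" "a < t" "t < b" using t by (auto simp: E_def)
    then obtain D where D: "(g has_vector_derivative D) (at t)" "norm D \<le> C" using Z' by blast
    then have "(g has_derivative (\<lambda>h. h *\<^sub>R D)) (at t)"
      by (simp add: has_vector_derivative_def)
    then obtain d where d: "d > 0"
      "\<And>y. norm (y - t) < d \<Longrightarrow> norm (g y - g t - (y - t) *\<^sub>R D) \<le> e * norm (y - t)"
      unfolding has_derivative_at_alt using e by blast
    show ?thesis
    proof (intro exI[of _ d] conjI allI impI)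
      fix u v assume uv: "u \<le> t \<and> t \<le> v \<and> u \<in> ball t d \<and> v \<in> ball t d"
      then have n: "norm (v - t) < d" "norm (u - t) < d" "norm (v - t) = v - t" "norm (u - t) = t - u"
        by (auto simp: dist_real_def)
      have 1: "norm (g v - g t - (v - t) *\<^sub>R D) \<le> e * (v - t)"
        using d(2)[of v] n by simp
      have 2: "norm (g u - g t - (u - t) *\<^sub>R D) \<le> e * (t - u)"
        using d(2)[of u] n by simp
      have "g v - g u = (g v - g t - (v - t) *\<^sub>R D) - (g u - g t - (u - t) *\<^sub>R D) + (v - u) *\<^sub>R D"
        by (simp add: algebra_simps)
      also have "norm \<dots> \<le> e * (v - t) + e * (t - u) + norm ((v - u) *\<^sub>R D)"
        by (intro norm_triangle_mono order.trans[OF norm_triangle_ineq4] add_mono 1 2 order.refl)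
      also have "norm ((v - u) *\<^sub>R D) \<le> (v - u) * C"
        using D(2) uv by (simp add: mult_left_mono)
      finally show "norm (g v - g u) \<le> (C + e) * (v - u)" by (simp add: algebra_simps)
    qed (use d in auto)
  qed
  then obtain d where d: "\<And>t. t \<notin> E \<Longrightarrow> a \<le> t \<Longrightarrow> t \<le> b \<Longrightarrow> d t > 0"
    "\<And>t u v. t \<notin> E \<Longrightarrow> a \<le> t \<Longrightarrow> t \<le> b \<Longrightarrow> u \<le> t \<and> t \<le> v \<and> u \<in> ball t (d t) \<and> v \<in> ball t (d t) \<Longrightarrow>
      norm (g v - g u) \<le> (C + e) * (v - u)"
    by metis
  define \<gamma> where "\<gamma> t = (if t \<in> E then U else if a \<le> t \<and> t \<le> b then ball t (d t) else ball t 1)" for t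
  have "gauge \<gamma>" using U(1,2) d(1) by (auto simp: gauge_def \<gamma>_def)
  then obtain p where p: "p tagged_division_of {a..b}" "\<gamma> fine p"
    using fine_division_exists_real by blast
  note pd = tagged_division_ofD[OF p(1)]
  have K: "\<exists>u v. K = {u..v} \<and> u \<le> x \<and> x \<le> v \<and> a \<le> u \<and> v \<le> b \<and> Sup K = v \<and> Inf K = u"
    if xK: "(x, K) \<in> p" for x K
  proof -
    obtain u v where uv: "K = {u..v}" using pd(4)[OF xK] by (auto simp: cbox_interval)
    with pd(2,3)[OF xK] show ?thesis by auto
  qed
  define q where "q = {(x, K) \<in> p. x \<in> E}"
  have q: "q \<subseteq> p" "finite q" using pd(1) by (auto simp: q_def intro: finite_subset)
  obtain \<pi> where \<pi>: "bij_betw \<pi> {..<card q} q"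
    using q(2) by (metis atLeast0LessThan ex_bij_betw_nat_finite)
  define u v where "u i = Inf (snd (\<pi> i))" and "v i = Sup (snd (\<pi> i))" for i
  have \<pi>q: "\<pi> i \<in> q" if "i < card q" for i using \<pi> that by (auto simp: bij_betw_def)
  have uv: "snd (\<pi> i) = {u i..v i} \<and> a \<le> u i \<and> u i \<le> v i \<and> v i \<le> b" if "i < card q" for i
    using K[of "fst (\<pi> i)" "snd (\<pi> i)"] \<pi>q[OF that] q(1) by (fastforce simp: u_def v_def)
  have disj: "disjoint_family_on (\<lambda>i. {u i<..<v i}) {..<card q}"
  proof (unfold disjoint_family_on_def, intro ballI impI)
    fix i j assume ij: "i \<in> {..<card q}" "j \<in> {..<card q}" "i \<noteq> j"
    then have "\<pi> i \<noteq> \<pi> j" using \<pi> by (auto simp: bij_betw_def dest: inj_onD)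
    then have "interior (snd (\<pi> i)) \<inter> interior (snd (\<pi> j)) = {}"
      using pd(5)[of "fst (\<pi> i)" "snd (\<pi> i)" "fst (\<pi> j)" "snd (\<pi> j)"] \<pi>q ij q(1) by (auto simp: prod_eq_iff)
    then show "{u i<..<v i} \<inter> {u j<..<v j} = {}" using uv ij by auto
  qed
  have sub: "{u i<..<v i} \<subseteq> U" if "i < card q" for i
  proof -
    obtain x K where xK: "\<pi> i = (x, K)" by (cases "\<pi> i")
    with \<pi>q[OF that] have "(x, K) \<in> p" "x \<in> E" by (auto simp: q_def)
    from fineD[OF p(2) this(1)] have "snd (\<pi> i) \<subseteq> U" using \<open>x \<in> E\<close> by (simp add: xK \<gamma>_def)
    then show ?thesis using uv[OF that] by auto
  qed
  have "ennreal (\<Sum>i<card q. v i - u i) = (\<Sum>i<card q. emeasure lborel {u i<..<v i})"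
    using uv by (subst sum_ennreal[symmetric]) auto
  also have "\<dots> = emeasure lborel (\<Union>i<card q. {u i<..<v i})"
    by (intro sum_emeasure disj) auto
  also have "\<dots> \<le> emeasure lborel U"
    using sub U(1) by (intro emeasure_mono) (auto simp: borel_open)
  finally have "ennreal (\<Sum>i<card q. v i - u i) < ennreal \<delta>" using U' by simp
  moreover have "0 \<le> (\<Sum>i<card q. v i - u i)" using uv by (intro sum_nonneg) auto
  ultimately have len: "(\<Sum>i<card q. v i - u i) < \<delta>" by (simp add: ennreal_less_iff)
  have bad: "(\<Sum>(x,K)\<in>q. norm (g (Sup K) - g (Inf K))) < e0 / 2"
  proof -
    have "(\<Sum>(x,K)\<in>q. norm (g (Sup K) - g (Inf K))) = (\<Sum>i<card q. norm (g (v i) - g (u i)))"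
      by (subst sum.reindex_bij_betw[OF \<pi>, symmetric]) (simp add: u_def v_def case_prod_beta)
    also have "\<dots> < e0 / 2" using uv by (intro ac' disj len) auto
    finally show ?thesis .
  qed
  have good: "(\<Sum>(x,K)\<in>p - q. norm (g (Sup K) - g (Inf K))) \<le> (C + e) * (b - a)"
  proof -
    have "(\<Sum>(x,K)\<in>p - q. norm (g (Sup K) - g (Inf K))) \<le> (\<Sum>(x,K)\<in>p - q. (C + e) * (Sup K - Inf K))"
    proof (rule sum_mono, clarify)
      fix x K assume xK: "(x, K) \<in> p" "(x, K) \<notin> q"
      then have x: "x \<notin> E" by (auto simp: q_def)
      from K[OF xK(1)] obtain u v where K': "K = {u..v}" "u \<le> x" "x \<le> v" "a \<le> u" "v \<le> b" "Sup K = v" "Inf K = u"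
        by blast
      have "K \<subseteq> ball x (d x)" using fineD[OF p(2) xK(1)] x K' by (simp add: \<gamma>_def)
      moreover have "u \<in> K" "v \<in> K" using K' by auto
      ultimately have "u \<in> ball x (d x)" "v \<in> ball x (d x)" by blast+
      then show "norm (g (Sup K) - g (Inf K)) \<le> (C + e) * (Sup K - Inf K)"
        using d(2)[of x u v] K' x by auto
    qed
    also have "\<dots> \<le> (\<Sum>(x,K)\<in>p. (C + e) * (Sup K - Inf K))"
      using pd(1) K C e by (intro sum_mono2) fastforce+
    also have "\<dots> = (C + e) * (\<Sum>(x,K)\<in>p. Sup K - Inf K)"
      by (simp add: sum_distrib_left case_prod_beta)
    also have "(\<Sum>(x,K)\<in>p. Sup K - Inf K) = b - a"
      using additive_tagged_division_1[OF ab p(1), of "\<lambda>x. x"] by simp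
    finally show ?thesis .
  qed
  have "g b - g a = (\<Sum>(x,K)\<in>p. g (Sup K) - g (Inf K))"
    using additive_tagged_division_1[OF ab p(1), of g] by simp
  also have "norm \<dots> \<le> (\<Sum>(x,K)\<in>p. norm (g (Sup K) - g (Inf K)))"
    by (rule order.trans[OF norm_sum]) (simp add: case_prod_beta)
  also have "\<dots> = (\<Sum>(x,K)\<in>p - q. norm (g (Sup K) - g (Inf K))) + (\<Sum>(x,K)\<in>q. norm (g (Sup K) - g (Inf K)))"
    using pd(1) q(1) by (simp add: sum.subset_diff)
  also have "\<dots> \<le> C * (b - a) + e0"
    using good bad e_le by (simp add: algebra_simps)
  finally show "norm (g b - g a) \<le> C * (b - a) + e0" .
qed

lemma absolutely_continuous_interval_subset:
  assumes "absolutely_continuous_interval a b g" "a \<le> a'" "b' \<le> b"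
  shows "absolutely_continuous_interval a' b' g"
proof (rule absolutely_continuous_intervalI)
  fix e :: real assume "e > 0"
  obtain \<delta> where \<delta>: "\<delta> > 0" and *:
    "\<And>(n::nat) u v. (\<forall>i<n. a \<le> u i \<and> u i \<le> v i \<and> v i \<le> b) \<Longrightarrow>
        disjoint_family_on (\<lambda>i. {u i<..<v i}) {..<n} \<Longrightarrow>
        (\<Sum>i<n. v i - u i) < \<delta> \<Longrightarrow> (\<Sum>i<n. norm (g (v i) - g (u i))) < e"
    by (rule absolutely_continuous_intervalE[OF assms(1) \<open>e > 0\<close>]) (rule that)
  show "\<exists>\<delta>>0. \<forall>(n::nat) u v. (\<forall>i<n. a' \<le> u i \<and> u i \<le> v i \<and> v i \<le> b') \<longrightarrow>
        disjoint_family_on (\<lambda>i. {u i<..<v i}) {..<n} \<longrightarrow>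
        (\<Sum>i<n. v i - u i) < \<delta> \<longrightarrow> (\<Sum>i<n. norm (g (v i) - g (u i))) < e"
  proof (intro exI[of _ \<delta>] conjI allI impI \<delta>)
    fix n :: nat and u v :: "nat \<Rightarrow> real"
    assume H: "\<forall>i<n. a' \<le> u i \<and> u i \<le> v i \<and> v i \<le> b'"
      "disjoint_family_on (\<lambda>i. {u i<..<v i}) {..<n}" "(\<Sum>i<n. v i - u i) < \<delta>"
    have "\<forall>i<n. a \<le> u i \<and> u i \<le> v i \<and> v i \<le> b" using H(1) assms(2,3) by fastforce
    from *[OF this H(2,3)] show "(\<Sum>i<n. norm (g (v i) - g (u i))) < e" .
  qed
qed

lemma absolutely_continuous_interval_diff:
  assumes "absolutely_continuous_interval a b g" "absolutely_continuous_interval a b h"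
  shows "absolutely_continuous_interval a b (\<lambda>t. g t - h t)"
proof (rule absolutely_continuous_intervalI)
  fix e :: real assume e: "e > 0"
  obtain \<delta>1 where \<delta>1: "\<delta>1 > 0" and 1:
    "\<And>(n::nat) u v. (\<forall>i<n. a \<le> u i \<and> u i \<le> v i \<and> v i \<le> b) \<Longrightarrow>
        disjoint_family_on (\<lambda>i. {u i<..<v i}) {..<n} \<Longrightarrow>
        (\<Sum>i<n. v i - u i) < \<delta>1 \<Longrightarrow> (\<Sum>i<n. norm (g (v i) - g (u i))) < e / 2"
    by (rule absolutely_continuous_intervalE[OF assms(1) half_gt_zero[OF e]]) (rule that)
  obtain \<delta>2 where \<delta>2: "\<delta>2 > 0" and 2:
    "\<And>(n::nat) u v. (\<forall>i<n. a \<le> u i \<and> u i \<le> v i \<and> v i \<le> b) \<Longrightarrow>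
        disjoint_family_on (\<lambda>i. {u i<..<v i}) {..<n} \<Longrightarrow>
        (\<Sum>i<n. v i - u i) < \<delta>2 \<Longrightarrow> (\<Sum>i<n. norm (h (v i) - h (u i))) < e / 2"
    by (rule absolutely_continuous_intervalE[OF assms(2) half_gt_zero[OF e]]) (rule that)
  show "\<exists>\<delta>>0. \<forall>(n::nat) u v. (\<forall>i<n. a \<le> u i \<and> u i \<le> v i \<and> v i \<le> b) \<longrightarrow>
        disjoint_family_on (\<lambda>i. {u i<..<v i}) {..<n} \<longrightarrow>
        (\<Sum>i<n. v i - u i) < \<delta> \<longrightarrow> (\<Sum>i<n. norm (g (v i) - h (v i) - (g (u i) - h (u i)))) < e"
  proof (intro exI[of _ "min \<delta>1 \<delta>2"] conjI allI impI)
    fix n :: nat and u v :: "nat \<Rightarrow> real"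
    assume H: "\<forall>i<n. a \<le> u i \<and> u i \<le> v i \<and> v i \<le> b"
      "disjoint_family_on (\<lambda>i. {u i<..<v i}) {..<n}" "(\<Sum>i<n. v i - u i) < min \<delta>1 \<delta>2"
    have "(\<Sum>i<n. norm (g (v i) - h (v i) - (g (u i) - h (u i))))
        \<le> (\<Sum>i<n. norm (g (v i) - g (u i)) + norm (h (v i) - h (u i)))"
      by (intro sum_mono order.trans[OF _ norm_triangle_ineq4]) (simp add: algebra_simps)
    also have "\<dots> < e / 2 + e / 2"
      unfolding sum.distrib using H by (intro add_strict_mono 1 2) auto
    finally show "(\<Sum>i<n. norm (g (v i) - h (v i) - (g (u i) - h (u i)))) < e" by simp
  qed (use \<delta>1 \<delta>2 in auto)
qed

lemma absolutely_continuous_interval_cong: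
  assumes "absolutely_continuous_interval a b g" "\<And>t. a \<le> t \<Longrightarrow> t \<le> b \<Longrightarrow> g t = h t"
  shows "absolutely_continuous_interval a b h"
proof (rule absolutely_continuous_intervalI)
  fix e :: real assume "e > 0"
  obtain \<delta> where \<delta>: "\<delta> > 0" and *:
    "\<And>(n::nat) u v. (\<forall>i<n. a \<le> u i \<and> u i \<le> v i \<and> v i \<le> b) \<Longrightarrow>
        disjoint_family_on (\<lambda>i. {u i<..<v i}) {..<n} \<Longrightarrow>
        (\<Sum>i<n. v i - u i) < \<delta> \<Longrightarrow> (\<Sum>i<n. norm (g (v i) - g (u i))) < e"
    by (rule absolutely_continuous_intervalE[OF assms(1) \<open>e > 0\<close>]) (rule that)
  show "\<exists>\<delta>>0. \<forall>(n::nat) u v. (\<forall>i<n. a \<le> u i \<and> u i \<le> v i \<and> v i \<le> b) \<longrightarrow>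
        disjoint_family_on (\<lambda>i. {u i<..<v i}) {..<n} \<longrightarrow>
        (\<Sum>i<n. v i - u i) < \<delta> \<longrightarrow> (\<Sum>i<n. norm (h (v i) - h (u i))) < e"
  proof (intro exI[of _ \<delta>] conjI allI impI \<delta>)
    fix n :: nat and u v :: "nat \<Rightarrow> real"
    assume H: "\<forall>i<n. a \<le> u i \<and> u i \<le> v i \<and> v i \<le> b"
      "disjoint_family_on (\<lambda>i. {u i<..<v i}) {..<n}" "(\<Sum>i<n. v i - u i) < \<delta>"
    have "h (v i) - h (u i) = g (v i) - g (u i)" if "i < n" for i
      using H(1)[rule_format, OF that] by (simp add: assms(2))
    then show "(\<Sum>i<n. norm (h (v i) - h (u i))) < e" using *[OF H] by simp
  qed
qed

lemma lipschitz_on_imp_absolutely_continuous_interval: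
  fixes g :: "real \<Rightarrow> 'b::real_normed_vector"
  assumes "L-lipschitz_on {a..b} g"
  shows "absolutely_continuous_interval a b g"
proof (rule absolutely_continuous_intervalI)
  fix e :: real assume e: "e > 0"
  have L: "L \<ge> 0" using assms by (rule lipschitz_on_nonneg)
  show "\<exists>\<delta>>0. \<forall>(n::nat) u v. (\<forall>i<n. a \<le> u i \<and> u i \<le> v i \<and> v i \<le> b) \<longrightarrow>
        disjoint_family_on (\<lambda>i. {u i<..<v i}) {..<n} \<longrightarrow>
        (\<Sum>i<n. v i - u i) < \<delta> \<longrightarrow> (\<Sum>i<n. norm (g (v i) - g (u i))) < e"
  proof (intro exI[of _ "e / (L + 1)"] conjI allI impI)
    fix n :: nat and u v :: "nat \<Rightarrow> real"
    assume H: "\<forall>i<n. a \<le> u i \<and> u i \<le> v i \<and> v i \<le> b" "(\<Sum>i<n. v i - u i) < e / (L + 1)"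
    have "(\<Sum>i<n. norm (g (v i) - g (u i))) \<le> (\<Sum>i<n. (L + 1) * (v i - u i))"
    proof (rule sum_mono)
      fix i assume "i \<in> {..<n}"
      then have i: "a \<le> u i" "u i \<le> v i" "v i \<le> b" using H(1) by auto
      have "norm (g (v i) - g (u i)) \<le> L * (v i - u i)"
        using lipschitz_onD[OF assms, of "v i" "u i"] i by (simp add: dist_norm)
      also have "\<dots> \<le> (L + 1) * (v i - u i)" using i by (intro mult_right_mono) auto
      finally show "norm (g (v i) - g (u i)) \<le> (L + 1) * (v i - u i)" .
    qed
    also have "\<dots> = (L + 1) * (\<Sum>i<n. v i - u i)" by (simp add: sum_distrib_left)
    also have "\<dots> < e" using H(2) L by (simp add: field_simps)
    finally show "(\<Sum>i<n. norm (g (v i) - g (u i))) < e" .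
  qed (use e L in auto)
qed

lemma absolutely_continuous_interval_imp_continuous_on:
  fixes g :: "real \<Rightarrow> 'b::real_normed_vector"
  assumes "absolutely_continuous_interval a b g"
  shows "continuous_on {a..b} g"
  unfolding continuous_on_iff
proof (intro ballI allI impI)
  fix x and e :: real assume x: "x \<in> {a..b}" and e: "0 < e"
  obtain \<delta> where \<delta>: "\<delta> > 0" and ac:
    "\<And>(n::nat) u v. (\<forall>i<n. a \<le> u i \<and> u i \<le> v i \<and> v i \<le> b) \<Longrightarrow>
        disjoint_family_on (\<lambda>i. {u i<..<v i}) {..<n} \<Longrightarrow>
        (\<Sum>i<n. v i - u i) < \<delta> \<Longrightarrow> (\<Sum>i<n. norm (g (v i) - g (u i))) < e"
    by (rule absolutely_continuous_intervalE[OF assms e]) (rule that)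
  have *: "norm (g v - g u) < e" if "a \<le> u" "u \<le> v" "v \<le> b" "v - u < \<delta>" for u v
    using ac[of 1 "\<lambda>_. u" "\<lambda>_. v"] that by (simp add: disjoint_family_on_def)
  show "\<exists>d>0. \<forall>x'\<in>{a..b}. dist x' x < d \<longrightarrow> dist (g x') (g x) < e"
  proof (intro exI[of _ \<delta>] conjI ballI impI \<delta>)
    fix x' assume x': "x' \<in> {a..b}" "dist x' x < \<delta>"
    show "dist (g x') (g x) < e"
    proof (cases "x \<le> x'")
      case True
      then show ?thesis using *[of x x'] x x' by (simp add: dist_norm)
    next
      case False
      then show ?thesis using *[of x' x] x x' by (simp add: dist_norm norm_minus_commute)
    qed
  qed
qed

text \<open>Gronwall's inequality in the only form needed. On an interval of length \<open>1 / (2 * L)\<close> that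
  starts at a zero of \<open>z\<close>, the maximum of \<open>norm z\<close> is at most half of itself, hence \<open>0\<close>; finitely many such
  intervals reach any time.\<close>

lemma absolutely_continuous_interval_eq_0:
  fixes z :: "real \<Rightarrow> 'b::real_normed_vector"
  assumes ac: "absolutely_continuous_interval 0 T z" and z0: "z 0 = 0"
    and der: "AE t in lborel. 0 < t \<and> t < T \<longrightarrow>
      (\<exists>d. (z has_vector_derivative d) (at t) \<and> norm d \<le> L * norm (z t))"
    and L: "L > 0" and t: "0 \<le> t" "t \<le> T"
  shows "z t = 0"
proof -
  define h where "h = 1 / (2 * L)"
  have h: "h > 0" using L by (simp add: h_def)
  have cont: "continuous_on {0..T} z"
    using ac by (rule absolutely_continuous_interval_imp_continuous_on)
  have step: "\<forall>s. 0 \<le> s \<and> s \<le> T \<and> s \<le> real n * h \<longrightarrow> z s = 0" for n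
  proof (induction n)
    case 0
    then show ?case using z0 by auto
  next
    case (Suc n)
    show ?case
    proof (cases "real n * h \<le> T")
      case False
      then show ?thesis using Suc by (auto simp: not_le)
    next
      case True
      define a b where "a = real n * h" and "b = min T (real (Suc n) * h)"
      have ab: "0 \<le> a" "a \<le> b" "b \<le> T" "b - a \<le> h"
        using True h by (auto simp: a_def b_def algebra_simps min_def)
      have za: "z a = 0" using Suc True h by (auto simp: a_def)
      have "\<exists>x\<in>{a..b}. \<forall>y\<in>{a..b}. norm (z y) \<le> norm (z x)"
        using ab by (intro continuous_attains_sup continuous_on_norm continuous_on_subset[OF cont]) auto
      then obtain m where m: "a \<le> m" "m \<le> b" "\<And>y. a \<le> y \<Longrightarrow> y \<le> b \<Longrightarrow> norm (z y) \<le> norm (z m)"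
        by auto
      have "norm (z m - z a) \<le> (L * norm (z m)) * (m - a)"
      proof (rule absolutely_continuous_interval_bound)
        show "absolutely_continuous_interval a m z"
          using ac ab m by (auto intro: absolutely_continuous_interval_subset)
        show "AE t in lborel. a < t \<and> t < m \<longrightarrow>
            (\<exists>d. (z has_vector_derivative d) (at t) \<and> norm d \<le> L * norm (z m))"
          using der
        proof (rule AE_mp, intro AE_I2 impI)
          fix t assume *: "0 < t \<and> t < T \<longrightarrow>
            (\<exists>d. (z has_vector_derivative d) (at t) \<and> norm d \<le> L * norm (z t))" and t: "a < t \<and> t < m"
          then obtain d where d: "(z has_vector_derivative d) (at t)" "norm d \<le> L * norm (z t)"
            using ab m by auto
          have "L * norm (z t) \<le> L * norm (z m)" using L t ab m by (intro mult_left_mono m) auto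
          with d show "\<exists>d. (z has_vector_derivative d) (at t) \<and> norm d \<le> L * norm (z m)" 
            by (meson order.trans)
        qed
      qed (use m L in auto)
      also have "\<dots> \<le> (L * norm (z m)) * h" using m ab L by (intro mult_left_mono) auto
      also have "\<dots> = norm (z m) / 2" using L by (simp add: h_def)
      finally have "norm (z m) \<le> 0" using za by simp
      then have zero: "z y = 0" if "a \<le> y" "y \<le> b" for y using m(3)[OF that] by simp
      show ?thesis
      proof (intro allI impI)
        fix s assume s: "0 \<le> s \<and> s \<le> T \<and> s \<le> real (Suc n) * h"
        show "z s = 0"
          using Suc zero[of s] s by (cases "s \<le> a") (auto simp: a_def b_def)
      qed
    qed
  qed
  obtain n :: nat where "t / h \<le> real n" using real_arch_simple by blast
  then show ?thesis using step[of n] t h by (auto simp: field_simps)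
qed

lemma caratheodory_unique:
  fixes f :: "'p \<Rightarrow> 'b::euclidean_space \<Rightarrow> 'b"
  assumes lip: "\<And>\<rho>. \<exists>L. \<forall>p\<in>P. L-lipschitz_on (cball 0 \<rho>) (f p)"
    and s: "\<And>t. 0 < t \<Longrightarrow> t < T \<Longrightarrow> s t \<in> P"
    and ac: "absolutely_continuous_interval 0 T x" "absolutely_continuous_interval 0 T y"
    and x: "AE t in lborel. 0 < t \<and> t < T \<longrightarrow> (x has_vector_derivative f (s t) (x t)) (at t)"
    and y: "AE t in lborel. 0 < t \<and> t < T \<longrightarrow> (y has_vector_derivative f (s t) (y t)) (at t)"
    and init: "x 0 = y 0" and t: "0 \<le> t" "t \<le> T"
  shows "x t = y t"
proof -
  have "bounded (x ` {0..T} \<union> y ` {0..T})"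
    using ac[THEN absolutely_continuous_interval_imp_continuous_on]
    by (auto intro!: compact_imp_bounded compact_continuous_image)
  then obtain \<rho> where \<rho>: "\<And>u. 0 \<le> u \<Longrightarrow> u \<le> T \<Longrightarrow> norm (x u) \<le> \<rho> \<and> norm (y u) \<le> \<rho>"
    unfolding bounded_iff by fastforce
  obtain L where L: "\<And>p. p \<in> P \<Longrightarrow> L-lipschitz_on (cball 0 \<rho>) (f p)" using lip by blast
  have "x t - y t = 0"
  proof (rule absolutely_continuous_interval_eq_0[where L = "\<bar>L\<bar> + 1" and T = T])
    show "absolutely_continuous_interval 0 T (\<lambda>t. x t - y t)"
      using ac by (rule absolutely_continuous_interval_diff)
    from x y show "AE t in lborel. 0 < t \<and> t < T \<longrightarrow>
      (\<exists>d. ((\<lambda>t. x t - y t) has_vector_derivative d) (at t) \<and> norm d \<le> (\<bar>L\<bar> + 1) * norm (x t - y t))"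
    proof (eventually_elim, intro impI)
      fix u assume H: "0 < u \<and> u < T \<longrightarrow> (x has_vector_derivative f (s u) (x u)) (at u)"
        "0 < u \<and> u < T \<longrightarrow> (y has_vector_derivative f (s u) (y u)) (at u)" and u: "0 < u \<and> u < T"
      have "norm (f (s u) (x u) - f (s u) (y u)) \<le> L * norm (x u - y u)"
        using lipschitz_onD[OF L, of "s u" "x u" "y u"] s[of u] u \<rho>[of u] by (simp add: dist_norm)
      also have "\<dots> \<le> (\<bar>L\<bar> + 1) * norm (x u - y u)" by (intro mult_right_mono) auto
      finally show "\<exists>d. ((\<lambda>t. x t - y t) has_vector_derivative d) (at u) \<and>
          norm d \<le> (\<bar>L\<bar> + 1) * norm (x u - y u)"
        using H u by (blast intro: has_vector_derivative_diff)
    qed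
  qed (use init t in auto)
  then show ?thesis by simp
qed

section \<open>Picard iteration with a random parameter\<close>

lemma set_integrable_bounded:
  fixes u :: "real \<Rightarrow> 'b::euclidean_space"
  assumes [measurable]: "u \<in> borel_measurable borel" and "\<And>s. norm (u s) \<le> B"
  shows "set_integrable lborel {a..b} u"
proof -
  have "set_integrable lborel {a..b} (\<lambda>_. B)"
    unfolding set_integrable_def
    by (intro integrable_scaleR_left integrable_real_indicator) (auto simp: emeasure_lborel_Icc_eq)
  then show ?thesis
    unfolding set_integrable_def
    by (rule Bochner_Integration.integrable_bound)
      (use assms(2) in \<open>auto simp: indicator_def intro: order.trans[OF _ abs_ge_self]\<close>)
qed

text \<open>Picard iteration for \<open>y' = h \<omega> t y\<close>, carried out for all sample points \<open>\<omega>\<close> at once so that the limit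
  is jointly measurable in \<open>(\<omega>, t)\<close>. The integrals are Lebesgue integrals, because those depend
  measurably on parameters; path by path they agree with Henstock-Kurzweil integrals, for which the
  fundamental theorem is at hand.\<close>

context
  fixes M :: "'a measure" and h :: "'a \<Rightarrow> real \<Rightarrow> 'b::euclidean_space \<Rightarrow> 'b" and B L :: real and x\<^sub>0 :: 'b
  assumes h_meas: "\<And>y. (\<lambda>(\<omega>, t). y \<omega> t) \<in> borel_measurable (M \<Otimes>\<^sub>M borel) \<Longrightarrow>
      (\<lambda>(\<omega>, t). h \<omega> t (y \<omega> t)) \<in> borel_measurable (M \<Otimes>\<^sub>M borel)"
    and h_bound: "\<And>\<omega> t x. \<omega> \<in> space M \<Longrightarrow> norm (h \<omega> t x) \<le> B"
    and h_lip: "\<And>\<omega> t x y. \<omega> \<in> space M \<Longrightarrow> norm (h \<omega> t x - h \<omega> t y) \<le> L * norm (x - y)"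
    and L: "1 \<le> L"
begin

primrec picard :: "nat \<Rightarrow> 'a \<Rightarrow> real \<Rightarrow> 'b" where
  "picard 0 \<omega> t = x\<^sub>0"
| "picard (Suc k) \<omega> t = x\<^sub>0 + (LINT s:{0..t}|lborel. h \<omega> s (picard k \<omega> s))"

declare picard.simps [simp del]

lemma picard_measurable: "(\<lambda>(\<omega>, t). picard k \<omega> t) \<in> borel_measurable (M \<Otimes>\<^sub>M borel)"
proof (induction k)
  case (Suc k)
  note [measurable] = h_meas[OF Suc]
  have "(\<lambda>x. \<integral>s. (if 0 \<le> s \<and> s \<le> snd x then (1::real) else 0) *\<^sub>R 
      (case (fst x, s) of (\<omega>, s) \<Rightarrow> h \<omega> s (picard k \<omega> s)) \<partial>lborel)
      \<in> borel_measurable (M \<Otimes>\<^sub>M borel)"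
    by measurable
  also have "(\<lambda>x. \<integral>s. (if 0 \<le> s \<and> s \<le> snd x then (1::real) else 0) *\<^sub>R 
      (case (fst x, s) of (\<omega>, s) \<Rightarrow> h \<omega> s (picard k \<omega> s)) \<partial>lborel) =
      (\<lambda>(\<omega>, t). LINT s:{0..t}|lborel. h \<omega> s (picard k \<omega> s))"
    by (auto simp: fun_eq_iff set_lebesgue_integral_def indicator_def intro!: Bochner_Integration.integral_cong)
  finally show ?case by (simp add: case_prod_beta picard.simps)
qed (simp add: picard.simps)

lemma path_measurable:
  assumes "(\<lambda>(\<omega>, t). y \<omega> t) \<in> borel_measurable (M \<Otimes>\<^sub>M borel)" "\<omega> \<in> space M"
  shows "(\<lambda>t. h \<omega> t (y \<omega> t)) \<in> borel_measurable borel"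
  using measurable_compose[OF measurable_Pair1'[OF assms(2)] h_meas[OF assms(1)]] by simp

lemma path_integral:
  assumes y: "(\<lambda>(\<omega>, t). y \<omega> t) \<in> borel_measurable (M \<Otimes>\<^sub>M borel)" and \<omega>: "\<omega> \<in> space M"
  shows "(\<lambda>s. h \<omega> s (y \<omega> s)) integrable_on {a..b}"
    "(LINT s:{a..b}|lborel. h \<omega> s (y \<omega> s)) = integral {a..b} (\<lambda>s. h \<omega> s (y \<omega> s))"
  by (intro set_borel_integral_eq_integral set_integrable_bounded[where B = B]
      path_measurable[OF y \<omega>] h_bound[OF \<omega>])+

text \<open>With the weight \<open>exp (2 * L * t)\<close> the integral operator contracts by \<open>1 / 2\<close> on the whole half
  line, so that no restriction to short time intervals is needed.\<close>

lemma picard_step: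
  assumes \<omega>: "\<omega> \<in> space M" and "0 \<le> t"
  shows "norm (picard (Suc k) \<omega> t - picard k \<omega> t) \<le> B * exp (2 * L * t) * (1 / 2) ^ k"
  using assms(2)
proof (induction k arbitrary: t)
  case 0
  have B: "0 \<le> B" by (rule order.trans[OF norm_ge_zero h_bound[OF \<omega>]])
  have "norm (integral {0..t} (\<lambda>s. h \<omega> s (picard 0 \<omega> s))) \<le> integral {0..t} (\<lambda>_. B)"
    by (intro integral_norm_bound_integral path_integral(1)[OF picard_measurable \<omega>] h_bound[OF \<omega>]) auto
  also have "\<dots> = B * t" using 0 by simp
  also have "t \<le> exp (2 * L * t)"
  proof -
    have "t \<le> 2 * L * t" using 0 L mult_right_mono[of 1 "2 * L" t] by simp
    also have "\<dots> \<le> exp (2 * L * t)" using exp_ge_add_one_self[of "2 * L * t"] by linarith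
    finally show ?thesis .
  qed
  finally show ?case using B path_integral(2)[OF picard_measurable[of 0] \<omega>]
    by (simp add: mult_left_mono picard.simps)
next
  case (Suc k)
  have B: "0 \<le> B" by (rule order.trans[OF norm_ge_zero h_bound[OF \<omega>]])
  have I: "((\<lambda>s. L * (B * exp (2 * L * s) * (1 / 2) ^ k)) has_integral
      B * exp (2 * L * t) / 2 * (1 / 2) ^ k - B * exp (2 * L * 0) / 2 * (1 / 2) ^ k) {0..t}"
    using Suc.prems L
    by (intro fundamental_theorem_of_calculus)
      (auto intro!: derivative_eq_intros simp: has_real_derivative_iff_has_vector_derivative[symmetric])
  have "picard (Suc (Suc k)) \<omega> t - picard (Suc k) \<omega> t =
      integral {0..t} (\<lambda>s. h \<omega> s (picard (Suc k) \<omega> s) - h \<omega> s (picard k \<omega> s))"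
    by (simp only: picard.simps(2)[of _ \<omega> t] path_integral(2)[OF picard_measurable \<omega>]
        Henstock_Kurzweil_Integration.integral_diff[OF path_integral(1)[OF picard_measurable \<omega>]
          path_integral(1)[OF picard_measurable \<omega>]] add_diff_cancel_left)
  also have "norm \<dots> \<le> integral {0..t} (\<lambda>s. L * (B * exp (2 * L * s) * (1 / 2) ^ k))"
  proof (rule integral_norm_bound_integral)
    show "(\<lambda>s. h \<omega> s (picard (Suc k) \<omega> s) - h \<omega> s (picard k \<omega> s)) integrable_on {0..t}"
      by (intro integrable_diff path_integral(1)[OF picard_measurable \<omega>])
    fix s assume "s \<in> {0..t}"
    then have "norm (picard (Suc k) \<omega> s - picard k \<omega> s) \<le> B * exp (2 * L * s) * (1 / 2) ^ k"
      using Suc.IH by simp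
    then show "norm (h \<omega> s (picard (Suc k) \<omega> s) - h \<omega> s (picard k \<omega> s))
        \<le> L * (B * exp (2 * L * s) * (1 / 2) ^ k)"
      using L by (intro order.trans[OF h_lip[OF \<omega>]] mult_left_mono) auto
  qed (rule has_integral_integrable[OF I])
  also have "\<dots> = B * exp (2 * L * t) / 2 * (1 / 2) ^ k - B / 2 * (1 / 2) ^ k"
    using integral_unique[OF I] by simp
  also have "\<dots> \<le> B * exp (2 * L * t) * (1 / 2) ^ Suc k" using B by simp
  finally show ?case .
qed

lemma picard_convergent:
  assumes \<omega>: "\<omega> \<in> space M" and t: "0 \<le> t"
  shows "convergent (\<lambda>k. picard k \<omega> t)"
proof -
  have "summable (\<lambda>k. picard (Suc k) \<omega> t - picard k \<omega> t)"
    by (rule summable_comparison_test'[where N = 0 and g = "\<lambda>k. B * exp (2 * L * t) * (1 / 2) ^ k"])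
      (simp_all add: summable_mult summable_geometric picard_step[OF \<omega> t])
  then have "convergent (\<lambda>n. \<Sum>k<n. picard (Suc k) \<omega> t - picard k \<omega> t)"
    by (simp add: summable_iff_convergent)
  then have "convergent (\<lambda>n. picard n \<omega> t - picard 0 \<omega> t)"
    by (simp only: sum_lessThan_telescope[of "\<lambda>k. picard k \<omega> t"])
  from convergent_add[OF convergent_const[of x\<^sub>0] this] show ?thesis by (simp add: picard.simps(1))
qed

lemma picard_solution:
  "\<exists>Y. (\<lambda>(\<omega>, t). Y \<omega> t) \<in> borel_measurable (M \<Otimes>\<^sub>M borel) \<and>
    (\<forall>\<omega>\<in>space M. \<forall>t\<ge>0. (\<lambda>s. h \<omega> s (Y \<omega> s)) integrable_on {0..t} \<and>
      Y \<omega> t = x\<^sub>0 + integral {0..t} (\<lambda>s. h \<omega> s (Y \<omega> s)))"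
proof -
  define Y where "Y \<omega> t = lim (\<lambda>k. picard k \<omega> t)" for \<omega> t
  have Y: "(\<lambda>(\<omega>, t). Y \<omega> t) \<in> borel_measurable (M \<Otimes>\<^sub>M borel)"
    using borel_measurable_lim_metric[OF picard_measurable] by (simp add: Y_def case_prod_beta)
  have "Y \<omega> t = x\<^sub>0 + integral {0..t} (\<lambda>s. h \<omega> s (Y \<omega> s))" if \<omega>: "\<omega> \<in> space M" and t: "0 \<le> t" for \<omega> t
  proof -
    have lim: "(\<lambda>k. picard k \<omega> s) \<longlonglongrightarrow> Y \<omega> s" if "0 \<le> s" for s
      unfolding Y_def by (rule picard_convergent[OF \<omega> that, unfolded convergent_LIMSEQ_iff])
    have hlim: "(\<lambda>k. h \<omega> s (picard k \<omega> s)) \<longlonglongrightarrow> h \<omega> s (Y \<omega> s)" if s: "0 \<le> s" for s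
    proof (rule Lim_null_comparison[THEN LIM_zero_cancel])
      show "eventually (\<lambda>k. norm (h \<omega> s (picard k \<omega> s) - h \<omega> s (Y \<omega> s)) \<le> L * norm (picard k \<omega> s - Y \<omega> s)) sequentially"
        using h_lip[OF \<omega>] by simp
      show "(\<lambda>k. L * norm (picard k \<omega> s - Y \<omega> s)) \<longlonglongrightarrow> 0"
        using tendsto_mult[OF tendsto_const[of L] tendsto_norm[OF LIM_zero[OF lim[OF s]]]] by simp
    qed
    have ind: "(\<lambda>s. indicator {0..t} s *\<^sub>R u s) \<in> borel_measurable lborel"
      if [measurable]: "u \<in> borel_measurable borel" for u :: "real \<Rightarrow> 'b"
      by measurable
    have "(\<lambda>k. LINT s:{0..t}|lborel. h \<omega> s (picard k \<omega> s)) \<longlonglongrightarrow> (LINT s:{0..t}|lborel. h \<omega> s (Y \<omega> s))"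
      unfolding set_lebesgue_integral_def
    proof (rule integral_dominated_convergence)
      show "integrable lborel (\<lambda>s. indicator {0..t} s *\<^sub>R B)"
        by (rule set_integrable_bounded[of "\<lambda>_. B" "norm B" 0 t, unfolded set_integrable_def]) auto
      show "AE s in lborel. (\<lambda>k. indicator {0..t} s *\<^sub>R h \<omega> s (picard k \<omega> s)) \<longlonglongrightarrow> indicator {0..t} s *\<^sub>R h \<omega> s (Y \<omega> s)"
        using hlim by (auto simp: indicator_def)
      show "AE s in lborel. norm (indicator {0..t} s *\<^sub>R h \<omega> s (picard k \<omega> s)) \<le> indicator {0..t} s *\<^sub>R B" for k
        using h_bound[OF \<omega>] by (auto simp: indicator_def)
    qed (intro ind path_measurable picard_measurable Y \<omega>)+
    then have 1: "(\<lambda>k. picard (Suc k) \<omega> t) \<longlonglongrightarrow> x\<^sub>0 + (LINT s:{0..t}|lborel. h \<omega> s (Y \<omega> s))"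
      unfolding picard.simps by (intro tendsto_add tendsto_const)
    have 2: "(\<lambda>k. picard (Suc k) \<omega> t) \<longlonglongrightarrow> Y \<omega> t" using lim[OF t] by (rule LIMSEQ_Suc)
    show ?thesis
      using LIMSEQ_unique[OF 2 1] by (simp only: path_integral(2)[OF Y \<omega>])
  qed
  then show ?thesis
    by (intro exI[of _ Y] conjI ballI allI impI Y path_integral(1)[OF Y])
qed

end

lemma integral_curve_lipschitz:
  fixes u :: "real \<Rightarrow> 'b::euclidean_space"
  assumes int: "\<And>t. 0 \<le> t \<Longrightarrow> u integrable_on {0..t}" and B: "\<And>t. norm (u t) \<le> B"
    and Y: "\<And>t. 0 \<le> t \<Longrightarrow> Y t = x\<^sub>0 + integral {0..t} u"
  shows "B-lipschitz_on {0..} Y"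
proof (rule lipschitz_onI)
  have *: "norm (Y b - Y a) \<le> B * (b - a)" if "0 \<le> a" "a \<le> b" for a b
  proof -
    have "u integrable_on {a..b}" using int[of b] that by (auto intro: integrable_subinterval_real)
    then have "norm (integral {a..b} u) \<le> integral {a..b} (\<lambda>_. B)"
      using B by (intro integral_norm_bound_integral) auto
    also have "\<dots> = B * (b - a)" using that by simp
    moreover have "integral {0..a} u + integral {a..b} u = integral {0..b} u"
      using int[of b] that by (intro Henstock_Kurzweil_Integration.integral_combine) auto
    then have "Y b - Y a = integral {a..b} u" using Y[of a] Y[of b] that by (simp add: algebra_simps)
    ultimately show ?thesis by (simp only:)
  qed
  fix a b :: real assume ab: "a \<in> {0..}" "b \<in> {0..}"
  show "dist (Y a) (Y b) \<le> B * dist a b"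
  proof (cases "a \<le> b")
    case True
    then show ?thesis using *[of a b] ab by (simp add: dist_norm norm_minus_commute)
  next
    case False
    then show ?thesis using *[of b a] ab by (simp add: dist_norm)
  qed
qed (rule order.trans[OF norm_ge_zero B[of 0]])

lemma integral_curve_has_vector_derivative:
  fixes u :: "real \<Rightarrow> 'b::euclidean_space"
  assumes int: "\<And>t. 0 \<le> t \<Longrightarrow> u integrable_on {0..t}"
    and Y: "\<And>t. 0 \<le> t \<Longrightarrow> Y t = x\<^sub>0 + integral {0..t} u"
    and t: "0 < t" and u: "isCont u t"
  shows "(Y has_vector_derivative u t) (at t)"
proof -
  have "((\<lambda>v. integral {0..v} u) has_vector_derivative u t) (at t within {0..t + 1} - {})"
  proof (rule integral_has_vector_derivative_continuous_at)
    show "u integrable_on {0..t + 1}" using t by (intro int) simp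
    show "continuous (at t within {0..t + 1} - {}) u"
      by (rule continuous_at_imp_continuous_at_within[OF u])
  qed (use t in simp_all)
  from has_vector_derivative_add[OF has_vector_derivative_const[of x\<^sub>0] this]
  have "((\<lambda>v. x\<^sub>0 + integral {0..v} u) has_vector_derivative u t) (at t within {0..t + 1})"
    by simp
  moreover have "at t within {0..t + 1} = at t"
    using t by (intro at_within_interior) simp
  ultimately have "((\<lambda>v. x\<^sub>0 + integral {0..v} u) has_vector_derivative u t) (at t)"
    by simp
  then show ?thesis
  proof (rule has_vector_derivative_transform_within_open)
    show "open {0::real<..}" "t \<in> {0<..}" using t by auto
    fix v :: real assume "v \<in> {0<..}"
    then have "0 \<le> v" by simp
    from Y[OF this] show "x\<^sub>0 + integral {0..v} u = Y v" by (rule sym)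
  qed
qed

section \<open>Switching times of cadlag paths in a discrete space\<close>

text \<open>The number of switches is additive over adjacent intervals, which suggests counting on \<open>]a, b]\<close>
  for general \<open>a\<close>.\<close>

definition switch_times :: "(real \<Rightarrow> 'p::topological_space) \<Rightarrow> real \<Rightarrow> real \<Rightarrow> real set" where
  "switch_times s a b = {u \<in> {a<..b}. \<not> isCont s u}"

lemma num_switches_eq: "num_switches s t = card (switch_times s 0 t)"
  by (simp add: num_switches_def switch_times_def)

lemma tendsto_discrete_iff_eventually_eq:
  "(s \<longlongrightarrow> (l :: 'p::discrete_topology)) F \<longleftrightarrow> eventually (\<lambda>x. s x = l) F"
  by (simp add: nhds_discrete filterlim_principal)

lemma isCont_if_locally_constant:
  fixes s :: "real \<Rightarrow> 'p::topological_space"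
  assumes "a < t" "t < b" "\<And>y. a < y \<Longrightarrow> y < b \<Longrightarrow> s y = p"
  shows "isCont s t"
proof -
  have "eventually (\<lambda>y. s y = p) (nhds t)"
    using eventually_nhds_in_open[of "{a<..<b}" t] assms by (auto elim!: eventually_mono)
  then have "isCont s t = isCont (\<lambda>_. p) t" by (rule isCont_cong)
  then show ?thesis by simp
qed

text \<open>Near \<open>x\<close> a cadlag path in a discrete space has at most two values: \<open>l\<close> before \<open>x\<close> and \<open>s x\<close> from \<open>x\<close> on.
  For \<open>x = 0\<close> the statements about the left side are void and \<open>l\<close> is arbitrary. All global facts
  about such paths follow from this local picture by bisection (the lemma \<open>Bolzano\<close>).\<close>

lemma cadlag_local:
  fixes s :: "real \<Rightarrow> 'p::discrete_topology"
  assumes s: "cadlag s" and x: "0 \<le> x"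
  obtains d l where "d > 0" "\<And>y. x \<le> y \<Longrightarrow> y < x + d \<Longrightarrow> s y = s x"
    "\<And>y. 0 \<le> y \<Longrightarrow> x - d < y \<Longrightarrow> y < x \<Longrightarrow> s y = l"
    "\<And>a b. 0 \<le> a \<Longrightarrow> a \<le> x \<Longrightarrow> x \<le> b \<Longrightarrow> b - a < d \<Longrightarrow>
      switch_times s a b = (if a < x \<and> l \<noteq> s x then {x} else {})"
proof -
  have "(s \<longlongrightarrow> s x) (at_right x)" using s x by (auto simp: cadlag_def)
  then obtain b0 where b0: "b0 > x" "\<And>y. x < y \<Longrightarrow> y < b0 \<Longrightarrow> s y = s x"
    unfolding tendsto_discrete_iff_eventually_eq eventually_at_right_field by blast
  have "\<exists>a0 l. a0 < x \<and> (x > 0 \<longrightarrow> 0 \<le> a0) \<and> (\<forall>y. 0 \<le> y \<and> a0 < y \<and> y < x \<longrightarrow> s y = l)"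
  proof (cases "x = 0")
    case True
    then show ?thesis by (intro exI[of _ "-1"]) auto
  next
    case False
    with x have "0 < x" by simp
    then obtain l where "(s \<longlongrightarrow> l) (at_left x)" using s unfolding cadlag_def by blast
    then obtain a0 where "a0 < x" "\<And>y. a0 < y \<Longrightarrow> y < x \<Longrightarrow> s y = l"
      unfolding tendsto_discrete_iff_eventually_eq eventually_at_left_field by blast
    then show ?thesis using False x by (intro exI[of _ "max 0 a0"] exI[of _ l]) auto
  qed
  then obtain a0 l where a0: "a0 < x" "x > 0 \<Longrightarrow> 0 \<le> a0"
    "\<And>y. 0 \<le> y \<Longrightarrow> a0 < y \<Longrightarrow> y < x \<Longrightarrow> s y = l" by blast
  define d where "d = min (b0 - x) (x - a0)"
  have d: "d > 0" using a0 b0 by (simp add: d_def)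
  have R: "s y = s x" if "x \<le> y" "y < x + d" for y
    using b0(2)[of y] that by (cases "y = x") (auto simp: d_def)
  have Lf: "s y = l" if "0 \<le> y" "x - d < y" "y < x" for y
    using a0(3)[of y] that by (auto simp: d_def)
  have ST: "switch_times s a b = (if a < x \<and> l \<noteq> s x then {x} else {})"
    if ab: "0 \<le> a" "a \<le> x" "x \<le> b" "b - a < d" for a b
  proof -
    have right: "isCont s u" if "x < u" "u \<le> b" for u
      using that ab by (intro isCont_if_locally_constant[of x u "x + d" s "s x"]) (auto intro!: R)
    have left: "isCont s u" if "a < u" "u < x" for u
      by (rule isCont_if_locally_constant[of a u x s l]) (use that ab Lf in auto)
    have mid: "isCont s x \<longleftrightarrow> l = s x" if ax: "a < x"
    proof
      assume "l = s x"
      then have c: "s y = l" if "a < y" "y < x + d" for y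
        using Lf[of y] R[of y] ab that \<open>l = s x\<close> by (cases "y < x") simp_all
      show "isCont s x"
        using that d by (intro isCont_if_locally_constant[of a x "x + d" s l]) (auto intro!: c)
    next
      assume "isCont s x"
      then have "(s \<longlongrightarrow> s x) (at_left x)"
        unfolding isCont_def by (rule filterlim_mono) (auto intro: at_le)
      then obtain a1 where a1: "a1 < x" "\<And>y. a1 < y \<Longrightarrow> y < x \<Longrightarrow> s y = s x"
        unfolding tendsto_discrete_iff_eventually_eq eventually_at_left_field by blast
      obtain y where "max a a1 < y" "y < x" using a1(1) ax dense[of "max a a1" x] by auto
      then show "l = s x" using a1(2)[of y] Lf[of y] ab by auto
    qed
    show ?thesis
    proof (cases "a < x \<and> l \<noteq> s x")
      case True
      have "u \<in> switch_times s a b \<longleftrightarrow> u = x" for u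
        using left[of u] right[of u] mid True ab unfolding switch_times_def
        by (cases u x rule: linorder_cases) auto
      then show ?thesis using True by auto
    next
      case False
      have "u \<notin> switch_times s a b" for u
      proof
        assume "u \<in> switch_times s a b"
        then have u: "a < u" "u \<le> b" "\<not> isCont s u" by (auto simp: switch_times_def)
        then have "u = x" using left[of u] right[of u] by (cases u x rule: linorder_cases) auto
        then show False using u mid False by blast
      qed
      then show ?thesis using False by auto
    qed
  qed
  from that[OF d R Lf ST] show thesis .
qed

lemma switch_times_split:
  assumes "a \<le> b" "b \<le> c"
  shows "switch_times s a c = switch_times s a b \<union> switch_times s b c"
    "switch_times s a b \<inter> switch_times s b c = {}"
  using assms by (auto simp: switch_times_def)

lemma finite_switch_times:
  fixes s :: "real \<Rightarrow> 'p::discrete_topology"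
  assumes s: "cadlag s" and "0 \<le> a"
  shows "finite (switch_times s a b)"
proof (cases "a \<le> b")
  case True
  then have "0 \<le> a \<longrightarrow> finite (switch_times s a b)"
  proof (induction rule: Bolzano)
    case (trans a b c)
    then show ?case by (auto simp: switch_times_split[of a b c])
  next
    case (local x)
    then have "0 \<le> x" using \<open>0 \<le> a\<close> by simp
    from cadlag_local[OF s this] obtain d l where "d > 0"
      "\<And>a b. 0 \<le> a \<Longrightarrow> a \<le> x \<Longrightarrow> x \<le> b \<Longrightarrow> b - a < d \<Longrightarrow>
        switch_times s a b = (if a < x \<and> l \<noteq> s x then {x} else {})" by metis
    then show ?case by (intro exI[of _ d]) auto
  qed
  then show ?thesis using assms by simp
qed (simp add: switch_times_def)

lemma card_switch_times_split:
  fixes s :: "real \<Rightarrow> 'p::discrete_topology"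
  assumes "cadlag s" "0 \<le> a" "a \<le> b" "b \<le> c"
  shows "card (switch_times s a c) = card (switch_times s a b) + card (switch_times s b c)"
  using assms by (simp add: switch_times_split[of a b c] card_Un_disjoint finite_switch_times)

lemma switch_times_empty_imp_const:
  fixes s :: "real \<Rightarrow> 'p::discrete_topology"
  assumes s: "cadlag s" and a: "0 \<le> a" "a \<le> t" and "switch_times s a t = {}"
  shows "s t = s a"
proof -
  have "0 \<le> a \<and> switch_times s a t = {} \<longrightarrow> s t = s a"
    using a(2)
  proof (induction rule: Bolzano)
    case (trans a b c)
    then show ?case by (auto simp: switch_times_split[of a b c])
  next
    case (local x)
    then have "0 \<le> x" using \<open>0 \<le> a\<close> by simp
    obtain d l where d: "d > 0"
      "\<And>y. x \<le> y \<Longrightarrow> y < x + d \<Longrightarrow> s y = s x"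
      "\<And>y. 0 \<le> y \<Longrightarrow> x - d < y \<Longrightarrow> y < x \<Longrightarrow> s y = l"
      "\<And>a b. 0 \<le> a \<Longrightarrow> a \<le> x \<Longrightarrow> x \<le> b \<Longrightarrow> b - a < d \<Longrightarrow>
        switch_times s a b = (if a < x \<and> l \<noteq> s x then {x} else {})" by (rule cadlag_local[OF s \<open>0 \<le> x\<close>]) (rule that)
    show ?case
    proof (intro exI[of _ d] conjI allI impI d(1))
      fix u v assume uv: "u \<le> x \<and> x \<le> v \<and> v - u < d" and e: "0 \<le> u \<and> switch_times s u v = {}"
      then have "u = x \<or> l = s x" using d(4)[of u v] by (auto split: if_splits)
      then have "s u = s x" using d(3)[of u] uv e by (cases "u = x") auto
      then show "s v = s u" using d(2)[of v] uv by auto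
    qed
  qed
  then show ?thesis using assms by simp
qed

text \<open>Right continuity reduces the absence of switches to countably many comparisons. The right end
  point \<open>b\<close> has to be listed separately since a path may jump exactly at an irrational \<open>b\<close>.\<close>

lemma switch_times_empty_iff_Rats:
  fixes s :: "real \<Rightarrow> 'p::discrete_topology"
  assumes s: "cadlag s" and a: "0 \<le> a" "a \<le> b"
  shows "switch_times s a b = {} \<longleftrightarrow> (\<forall>t\<in>(\<rat> \<inter> {a..b}) \<union> {b}. s t = s a)"
proof safe
  fix t assume "switch_times s a b = {}" "t \<in> \<rat>" "t \<in> {a..b}"
  moreover from this have "switch_times s a t = {}" by (auto simp: switch_times_def)
  ultimately show "s t = s a" using s a by (auto intro: switch_times_empty_imp_const)
next
  assume "switch_times s a b = {}"
  then show "s b = s a" using s a by (auto intro: switch_times_empty_imp_const)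
next
  fix u assume H: "\<forall>t\<in>(\<rat> \<inter> {a..b}) \<union> {b}. s t = s a" and u: "u \<in> switch_times s a b"
  have const: "s t = s a" if t: "a \<le> t" "t \<le> b" for t
  proof (cases "t = b")
    case False
    from t a have "0 \<le> t" by simp
    from cadlag_local[OF s this] obtain d where d: "d > 0"
      "\<And>y. t \<le> y \<Longrightarrow> y < t + d \<Longrightarrow> s y = s t" by metis
    obtain r where "r \<in> \<rat>" "t < r" "r < min b (t + d)"
      using Rats_dense_in_real[of t "min b (t + d)"] d(1) t False by auto
    then show ?thesis using d(2)[of r] H t by auto
  qed (use H in auto)
  have u': "a < u" "u \<le> b" "\<not> isCont s u" using u by (auto simp: switch_times_def)
  then have "0 \<le> u" using a by simp
  from cadlag_local[OF s this] obtain d l where d: "d > 0"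
      "\<And>y. 0 \<le> y \<Longrightarrow> u - d < y \<Longrightarrow> y < u \<Longrightarrow> s y = l"
      "\<And>a b. 0 \<le> a \<Longrightarrow> a \<le> u \<Longrightarrow> u \<le> b \<Longrightarrow> b - a < d \<Longrightarrow>
        switch_times s a b = (if a < u \<and> l \<noteq> s u then {u} else {})" by metis
  obtain y where y: "max a (u - d) < y" "y < u" using d(1) u' dense[of "max a (u - d)" u] by auto
  then have "l = s u" using d(2)[of y] const[of y] const[of u] u' a by auto
  then have "switch_times s y u = {}" using d(3)[of y u] y a by auto
  moreover have "u \<in> switch_times s y u" using u' y by (auto simp: switch_times_def)
  ultimately show "u \<in> {}" by simp
qed

text \<open>A rational time just before the last switch separates it from the earlier ones. This recursion
  makes the events "at least \<open>k\<close> switches" measurable.\<close>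

lemma Suc_le_card_switch_times_iff:
  fixes s :: "real \<Rightarrow> 'p::discrete_topology"
  assumes s: "cadlag s" and t: "0 \<le> t"
  shows "Suc k \<le> card (switch_times s 0 t) \<longleftrightarrow>
    (\<exists>q\<in>\<rat> \<inter> {0..<t}. k \<le> card (switch_times s 0 q) \<and> switch_times s q t \<noteq> {})" (is "?L \<longleftrightarrow> ?R")
proof
  assume ?L
  note fin = finite_switch_times[OF s order.refl]
  define u where "u = Max (switch_times s 0 t)"
  have "switch_times s 0 t \<noteq> {}" using \<open>?L\<close> by auto
  then have u: "u \<in> switch_times s 0 t" using fin by (simp add: u_def)
  define S where "S = switch_times s 0 t - {u}"
  define v where "v = Max (insert 0 S)"
  have "x < u" if "x \<in> insert 0 S" for x
    using that u Max_ge[OF fin, of x] unfolding S_def u_def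
    by (auto simp: switch_times_def order_less_le)
  then have "v < u" using fin by (simp add: v_def S_def)
  then obtain q where q: "q \<in> \<rat>" "v < q" "q < u" using Rats_dense_in_real by blast
  have v: "0 \<le> v" "\<And>x. x \<in> S \<Longrightarrow> x \<le> v" using fin by (simp_all add: v_def S_def)
  have "S \<subseteq> switch_times s 0 q" using v q by (force simp: S_def switch_times_def)
  then have "card S \<le> card (switch_times s 0 q)" by (intro card_mono fin)
  moreover have "Suc k \<le> Suc (card S)" 
    using \<open>?L\<close> u fin unfolding S_def by (metis card_Suc_Diff1)
  moreover have "u \<in> switch_times s q t" using u q by (auto simp: switch_times_def)
  ultimately show ?R using q v u by (intro bexI[of _ q]) (auto simp: switch_times_def)
next
  assume ?R
  then obtain q where "q \<in> {0..<t}" and q': "k \<le> card (switch_times s 0 q)" "switch_times s q t \<noteq> {}"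
    by blast
  with q' have q: "0 \<le> q" "q < t" "k \<le> card (switch_times s 0 q)" "switch_times s q t \<noteq> {}"
    by auto
  then have "0 < card (switch_times s q t)" using finite_switch_times[OF s] by (simp add: card_gt_0_iff)
  then show ?L using q card_switch_times_split[OF s order.refl, of q t] by simp
qed

context
  fixes M :: "'a measure" and \<sigma> :: "real \<Rightarrow> 'a \<Rightarrow> nat"
  assumes meas: "\<And>t. 0 \<le> t \<Longrightarrow> \<sigma> t \<in> M \<rightarrow>\<^sub>M count_space UNIV"
    and cad: "\<And>\<omega>. \<omega> \<in> space M \<Longrightarrow> cadlag (\<lambda>t. \<sigma> t \<omega>)"
begin

lemma sets_eq_at_times:
  assumes "0 \<le> a" "0 \<le> b"
  shows "{\<omega> \<in> space M. \<sigma> a \<omega> = \<sigma> b \<omega>} \<in> sets M"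
proof -
  have [measurable]: "(\<lambda>\<omega>. real (\<sigma> t \<omega>)) \<in> borel_measurable M" if "t \<in> {a, b}" for t
    using that assms by (intro measurable_compose[OF meas[of t]]) auto
  have "{\<omega> \<in> space M. real (\<sigma> a \<omega>) = real (\<sigma> b \<omega>)} \<in> sets M" by measurable
  then show ?thesis by simp
qed

lemma sets_no_switch:
  assumes "0 \<le> a" "a \<le> b"
  shows "{\<omega> \<in> space M. switch_times (\<lambda>t. \<sigma> t \<omega>) a b = {}} \<in> sets M"
proof -
  have "{\<omega> \<in> space M. switch_times (\<lambda>t. \<sigma> t \<omega>) a b = {}} =
      {\<omega> \<in> space M. \<forall>t\<in>(\<rat> \<inter> {a..b}) \<union> {b}. \<sigma> t \<omega> = \<sigma> a \<omega>}"
    using switch_times_empty_iff_Rats[OF cad assms] by auto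
  also have "\<dots> \<in> sets M"
    using assms by (intro sets.sets_Collect_countable_All' sets_eq_at_times)
      (auto intro: countable_subset[OF _ countable_rat])
  finally show ?thesis .
qed

lemma sets_card_switch_times_ge:
  assumes "0 \<le> t"
  shows "{\<omega> \<in> space M. k \<le> card (switch_times (\<lambda>t. \<sigma> t \<omega>) 0 t)} \<in> sets M"
  using assms
proof (induction k arbitrary: t)
  case (Suc k)
  have "{\<omega> \<in> space M. Suc k \<le> card (switch_times (\<lambda>t. \<sigma> t \<omega>) 0 t)} =
    {\<omega> \<in> space M. \<exists>q\<in>\<rat> \<inter> {0..<t}. k \<le> card (switch_times (\<lambda>t. \<sigma> t \<omega>) 0 q) \<and>
        \<not> switch_times (\<lambda>t. \<sigma> t \<omega>) q t = {}}"
    using Suc_le_card_switch_times_iff[OF cad Suc.prems] by auto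
  also have "\<dots> \<in> sets M"
    using Suc by (intro sets.sets_Collect_countable_Ex' sets.sets_Collect_conj sets.sets_Collect_neg sets_no_switch)
      (auto intro: countable_subset[OF _ countable_rat])
  finally show ?case .
qed simp

lemma measurable_num_switches:
  assumes "0 \<le> t"
  shows "(\<lambda>\<omega>. num_switches (\<lambda>u. \<sigma> u \<omega>) t) \<in> M \<rightarrow>\<^sub>M count_space UNIV"
proof -
  have "{\<omega> \<in> space M. card (switch_times (\<lambda>t. \<sigma> t \<omega>) 0 t) = k} \<in> sets M" for k
  proof -
    have "{\<omega> \<in> space M. card (switch_times (\<lambda>t. \<sigma> t \<omega>) 0 t) = k} =
      {\<omega> \<in> space M. k \<le> card (switch_times (\<lambda>t. \<sigma> t \<omega>) 0 t)} -
      {\<omega> \<in> space M. Suc k \<le> card (switch_times (\<lambda>t. \<sigma> t \<omega>) 0 t)}" by auto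
    then show ?thesis using sets_card_switch_times_ge[OF assms] by auto
  qed
  then show ?thesis
    by (auto simp: measurable_count_space_eq2_countable num_switches_eq vimage_def Int_def conj_commute)
qed

text \<open>The process is the limit of its values at the grid points \<open>\<tau> n t\<close>, which converge to \<open>max 0 t\<close>
  strictly from the right; in a discrete space this limit is attained from some \<open>n\<close> on.\<close>

lemma cadlag_jointly_measurable:
  "(\<lambda>(\<omega>, t). \<sigma> (max 0 t) \<omega>) \<in> M \<Otimes>\<^sub>M borel \<rightarrow>\<^sub>M count_space UNIV"
proof -
  define \<tau> where "\<tau> n t = (of_int \<lfloor>real (Suc n) * max 0 t\<rfloor> + 1) / real (Suc n)" for n :: nat and t :: real
  have approx: "(\<lambda>(\<omega>, t). \<sigma> (\<tau> n t) \<omega>) \<in> M \<Otimes>\<^sub>M borel \<rightarrow>\<^sub>M count_space UNIV" for n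
  proof -
    have fl: "(\<lambda>x. \<lfloor>real (Suc n) * max 0 (snd x)\<rfloor>) \<in> (M \<Otimes>\<^sub>M borel) \<rightarrow>\<^sub>M count_space UNIV"
      by measurable
    have *: "(\<lambda>x. \<sigma> ((of_int (max 0 i) + 1) / real (Suc n)) (fst x)) \<in> M \<Otimes>\<^sub>M (borel :: real measure) \<rightarrow>\<^sub>M count_space UNIV"
      for i :: int
      by (intro measurable_compose[OF measurable_fst] meas) auto
    have "(\<lambda>x. \<sigma> ((of_int (max 0 \<lfloor>real (Suc n) * max 0 (snd x)\<rfloor>) + 1) / real (Suc n)) (fst x))
        \<in> M \<Otimes>\<^sub>M (borel :: real measure) \<rightarrow>\<^sub>M count_space UNIV"
      by (rule measurable_compose_countable[OF * fl])
    also have "(\<lambda>x. \<sigma> ((of_int (max 0 \<lfloor>real (Suc n) * max 0 (snd x)\<rfloor>) + 1) / real (Suc n)) (fst x)) =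
        (\<lambda>(\<omega>, t). \<sigma> (\<tau> n t) \<omega>)"
      by (auto simp: fun_eq_iff \<tau>_def max_def)
    finally show ?thesis .
  qed
  have \<tau>: "max 0 t < \<tau> n t" "\<tau> n t \<le> max 0 t + 1 / real (Suc n)" for n t
  proof -
    have "real (Suc n) * max 0 t < of_int \<lfloor>real (Suc n) * max 0 t\<rfloor> + 1" by linarith
    then show "max 0 t < \<tau> n t"
      unfolding \<tau>_def by (subst pos_less_divide_eq) (simp_all only: mult.commute of_nat_0_less_iff zero_less_Suc)
    have "of_int \<lfloor>real (Suc n) * max 0 t\<rfloor> \<le> real (Suc n) * max 0 t" by linarith
    then show "\<tau> n t \<le> max 0 t + 1 / real (Suc n)"
      using pos_divide_le_eq[of "real (Suc n)" "of_int \<lfloor>real (Suc n) * max 0 t\<rfloor>" "max 0 t"]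
      unfolding \<tau>_def add_divide_distrib by (simp add: mult.commute del: of_nat_Suc)
  qed
  have ev: "\<exists>m. \<forall>n\<ge>m. \<sigma> (\<tau> n t) \<omega> = \<sigma> (max 0 t) \<omega>" if \<omega>: "\<omega> \<in> space M" for \<omega> t
  proof -
    obtain d where d: "d > 0" "\<And>y. max 0 t \<le> y \<Longrightarrow> y < max 0 t + d \<Longrightarrow> \<sigma> y \<omega> = \<sigma> (max 0 t) \<omega>"
      by (rule cadlag_local[OF cad[OF \<omega>] max.cobounded1[of 0 t]]) (rule that)
    obtain m where m: "1 / real (Suc m) < d" using d(1) nat_approx_posE by blast
    show ?thesis
    proof (intro exI[of _ m] allI impI d(2))
      fix n assume "m \<le> n"
      then have "1 / real (Suc n) \<le> 1 / real (Suc m)" by (simp add: frac_le)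
      then show "\<tau> n t < max 0 t + d" using \<tau>(2)[of n t] m by linarith
    qed (use \<tau>(1) in \<open>auto intro: less_imp_le\<close>)
  qed
  have "{x \<in> space (M \<Otimes>\<^sub>M borel). \<sigma> (max 0 (snd x)) (fst x) = p} \<in> sets (M \<Otimes>\<^sub>M borel)" for p
  proof -
    have "{x \<in> space (M \<Otimes>\<^sub>M borel). \<sigma> (max 0 (snd x)) (fst x) = p} =
      {x \<in> space (M \<Otimes>\<^sub>M borel). \<exists>m. \<forall>n. m \<le> n \<longrightarrow> (case x of (\<omega>, t) \<Rightarrow> \<sigma> (\<tau> n t) \<omega>) = p}"
    proof (safe)
      fix \<omega> and t :: real assume "(\<omega>, t) \<in> space (M \<Otimes>\<^sub>M borel)"
      then have \<omega>: "\<omega> \<in> space M" by (simp add: space_pair_measure)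
      show "\<exists>m. \<forall>n. m \<le> n \<longrightarrow> \<sigma> (\<tau> n t) \<omega> = \<sigma> (max 0 (snd (\<omega>, t))) (fst (\<omega>, t))" using ev[OF \<omega>, of t] by simp
      fix m assume H: "\<forall>n. m \<le> n \<longrightarrow> \<sigma> (\<tau> n t) \<omega> = p"
      obtain m' where "\<forall>n\<ge>m'. \<sigma> (\<tau> n t) \<omega> = \<sigma> (max 0 t) \<omega>" using ev[OF \<omega>, of t] by blast
      then show "\<sigma> (max 0 (snd (\<omega>, t))) (fst (\<omega>, t)) = p" using H by (metis fst_conv snd_conv nle_le)
    qed
    also have "\<dots> \<in> sets (M \<Otimes>\<^sub>M borel)"
      using approx by measurable
    finally show ?thesis .
  qed
  then show ?thesis
    by (auto simp: measurable_count_space_eq2_countable vimage_def Int_def conj_commute case_prod_beta)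
qed

end

section \<open>Multiple Lyapunov functions along switched solutions\<close>

lemma lyapunov_nonincreasing:
  fixes V :: "'b::real_normed_vector \<Rightarrow> real"
  assumes ab: "a \<le> b" and cont: "continuous_on {a..b} y"
    and der: "\<And>t. a < t \<Longrightarrow> t < b \<Longrightarrow> (y has_vector_derivative g (y t)) (at t)"
    and V: "\<And>x. V differentiable (at x)"
    and decr: "\<And>t. a < t \<Longrightarrow> t < b \<Longrightarrow> frechet_derivative V (at (y t)) (g (y t)) \<le> - c * V (y t)"
  shows "V (y b) \<le> exp (- c * (b - a)) * V (y a)"
proof -
  have Vcont: "continuous_on UNIV V"
    using V by (auto intro: continuous_at_imp_continuous_on differentiable_imp_continuous_within)
  have "exp (c * b) * V (y b) \<le> exp (c * a) * V (y a)"
  proof (rule DERIV_nonpos_imp_decreasing_open[OF ab])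
    fix t assume t: "a < t" "t < b"
    have "((V \<circ> y) has_derivative (frechet_derivative V (at (y t)) \<circ> (\<lambda>h. h *\<^sub>R g (y t)))) (at t)"
      using der[OF t] V frechet_derivative_works
      by (intro diff_chain_at) (auto simp: has_vector_derivative_def)
    moreover have "linear (frechet_derivative V (at (y t)))"
      using V by (rule linear_frechet_derivative)
    ultimately have "((\<lambda>s. V (y s)) has_real_derivative frechet_derivative V (at (y t)) (g (y t))) (at t)"
      by (simp add: o_def linear_cmul has_field_derivative_def mult_commute_abs)
    then have "((\<lambda>s. exp (c * s) * V (y s)) has_real_derivative
        exp (c * t) * (c * V (y t) + frechet_derivative V (at (y t)) (g (y t)))) (at t)"
      by (auto intro!: derivative_eq_intros simp: algebra_simps)
    moreover have "exp (c * t) * (c * V (y t) + frechet_derivative V (at (y t)) (g (y t))) \<le> 0"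
      using decr[OF t] by (simp add: mult_le_0_iff)
    ultimately show "\<exists>D. ((\<lambda>s. exp (c * s) * V (y s)) has_real_derivative D) (at t) \<and> D \<le> 0"
      by blast
  next
    show "continuous_on {a..b} (\<lambda>s. exp (c * s) * V (y s))"
      by (intro continuous_intros continuous_on_compose2[OF Vcont cont]) auto
  qed
  then have "exp (- c * b) * (exp (c * b) * V (y b)) \<le> exp (- c * b) * (exp (c * a) * V (y a))"
    by (intro mult_left_mono) auto
  moreover have "exp (- c * b) * (exp (c * b) * z) = z" for z :: real by (simp add: exp_minus)
  moreover have "exp (- c * b) * (exp (c * a) * z) = exp (- c * (b - a)) * z" for z :: real
    unfolding mult.assoc[symmetric] exp_add[symmetric] by (simp add: algebra_simps)
  ultimately show ?thesis by (simp only:)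
qed

text \<open>Between switches the active Lyapunov function decays at rate \<open>c\<close>, and every switch costs at most
  a factor \<open>\<mu>\<close>. The estimate composes over adjacent intervals, so it only has to be checked on short
  ones, where at most one switch occurs.\<close>

lemma multiple_lyapunov_bound:
  fixes V :: "'p::discrete_topology \<Rightarrow> 'b::real_normed_vector \<Rightarrow> real" and s :: "real \<Rightarrow> 'p"
  assumes s: "cadlag s" and sP: "\<And>t. 0 \<le> t \<Longrightarrow> s t \<in> P"
    and cont: "continuous_on {0..T} y"
    and der: "\<And>t. 0 < t \<Longrightarrow> t < T \<Longrightarrow> isCont s t \<Longrightarrow> (y has_vector_derivative g (s t) (y t)) (at t)"
    and V: "\<And>p x. p \<in> P \<Longrightarrow> V p differentiable (at x)"
    and V0: "\<And>p x. p \<in> P \<Longrightarrow> 0 \<le> V p x"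
    and decr: "\<And>p t. p \<in> P \<Longrightarrow> 0 < t \<Longrightarrow> t < T \<Longrightarrow>
      frechet_derivative (V p) (at (y t)) (g p (y t)) \<le> - c * V p (y t)"
    and \<mu>: "1 \<le> \<mu>" "\<And>p q x. p \<in> P \<Longrightarrow> q \<in> P \<Longrightarrow> V p x \<le> \<mu> * V q x"
    and T: "0 \<le> T"
  shows "V (s T) (y T) \<le> \<mu> ^ num_switches s T * exp (- c * T) * V (s 0) (y 0)"
proof -
  let ?B = "\<lambda>a b. \<mu> ^ card (switch_times s a b) * exp (- c * (b - a))"
  from T have "0 \<le> (0::real) \<and> T \<le> T \<longrightarrow> V (s T) (y T) \<le> ?B 0 T * V (s 0) (y 0)"
  proof (rule Bolzano[where P = "\<lambda>a b. 0 \<le> a \<and> b \<le> T \<longrightarrow> V (s b) (y b) \<le> ?B a b * V (s a) (y a)"])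
    fix a b c' :: real
    assume trans: "0 \<le> a \<and> b \<le> T \<longrightarrow> V (s b) (y b) \<le> ?B a b * V (s a) (y a)"
      "0 \<le> b \<and> c' \<le> T \<longrightarrow> V (s c') (y c') \<le> ?B b c' * V (s b) (y b)" "a \<le> b" "b \<le> c'"
    show "0 \<le> a \<and> c' \<le> T \<longrightarrow> V (s c') (y c') \<le> ?B a c' * V (s a) (y a)"
    proof
      assume H: "0 \<le> a \<and> c' \<le> T"
      then have "V (s c') (y c') \<le> ?B b c' * V (s b) (y b)" using trans by auto
      also have "\<dots> \<le> ?B b c' * (?B a b * V (s a) (y a))"
        using trans H \<mu> by (intro mult_left_mono) auto
      also have "\<dots> = ?B a c' * V (s a) (y a)"
        using trans H by (simp add: card_switch_times_split[OF s, of a b c'] power_add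
            exp_add[symmetric] algebra_simps)
      finally show "V (s c') (y c') \<le> ?B a c' * V (s a) (y a)" .
    qed
  next
    fix x :: real assume "0 \<le> x"
    obtain d l where d: "d > 0"
      "\<And>y. x \<le> y \<Longrightarrow> y < x + d \<Longrightarrow> s y = s x"
      "\<And>y. 0 \<le> y \<Longrightarrow> x - d < y \<Longrightarrow> y < x \<Longrightarrow> s y = l"
      "\<And>a b. 0 \<le> a \<Longrightarrow> a \<le> x \<Longrightarrow> x \<le> b \<Longrightarrow> b - a < d \<Longrightarrow>
        switch_times s a b = (if a < x \<and> l \<noteq> s x then {x} else {})"
      by (rule cadlag_local[OF s \<open>0 \<le> x\<close>]) (rule that)
    show "\<exists>d>0. \<forall>a b. a \<le> x \<and> x \<le> b \<and> b - a < d \<longrightarrow>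
        0 \<le> a \<and> b \<le> T \<longrightarrow> V (s b) (y b) \<le> ?B a b * V (s a) (y a)"
    proof (intro exI[of _ d] conjI allI impI d(1))
      fix a b assume ab: "a \<le> x \<and> x \<le> b \<and> b - a < d" and H: "0 \<le> a \<and> b \<le> T"
      have piece: "V p (y v) \<le> exp (- c * (v - u)) * V p (y u)"
        if uv: "0 \<le> u" "u \<le> v" "v \<le> T" and p: "p \<in> P" "\<And>t. u < t \<Longrightarrow> t < v \<Longrightarrow> s t = p" for u v p
      proof (rule lyapunov_nonincreasing[OF uv(2), where g = "g p"])
        show "continuous_on {u..v} y" using uv by (auto intro: continuous_on_subset[OF cont])
        fix t assume t: "u < t" "t < v"
        have "isCont s t" using isCont_if_locally_constant[of u t v s p] p(2) t by auto
        then show "(y has_vector_derivative g p (y t)) (at t)" using der[of t] p(2)[OF t] t uv by auto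
        show "frechet_derivative (V p) (at (y t)) (g p (y t)) \<le> - c * V p (y t)"
          using decr[OF p(1), of t] t uv by auto
      qed (use V p in auto)
      have sx: "s x \<in> P" "s b = s x" using sP \<open>0 \<le> x\<close> d(2)[of b] ab by auto
      have right: "V (s b) (y b) \<le> exp (- c * (b - x)) * V (s x) (y x)"
        unfolding sx(2) using ab H \<open>0 \<le> x\<close> sx by (intro piece) (auto intro!: d(2))
      show "V (s b) (y b) \<le> ?B a b * V (s a) (y a)"
      proof (cases "a = x")
        case True
        then show ?thesis using right d(4)[of a b] ab H by simp
      next
        case False
        then have sa: "s a = l" using d(3)[of a] ab H by auto
        then have l: "l \<in> P" using sP[of a] H by simp
        have left: "V l (y x) \<le> exp (- c * (x - a)) * V l (y a)"
          using ab H l by (intro piece) (auto intro!: d(3))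
        have jump: "V (s x) (y x) \<le> \<mu> ^ card (switch_times s a b) * V l (y x)"
        proof (cases "l = s x")
          case True
          then show ?thesis using d(4)[of a b] ab H by simp
        next
          case neq: False
          then have "switch_times s a b = {x}" using d(4)[of a b] ab H False by simp
          then show ?thesis using \<mu>(2)[OF sx(1) l] by simp
        qed
        note right
        also have "exp (- c * (b - x)) * V (s x) (y x) \<le>
            exp (- c * (b - x)) * (\<mu> ^ card (switch_times s a b) * V l (y x))"
          by (intro mult_left_mono jump) auto
        also have "\<dots> \<le> exp (- c * (b - x)) * (\<mu> ^ card (switch_times s a b) * (exp (- c * (x - a)) * V l (y a)))"
          using \<mu>(1) by (intro mult_left_mono left) auto
        also have "\<dots> = ?B a b * V (s a) (y a)"
          unfolding sa by (simp add: exp_add[symmetric] algebra_simps)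
        finally show ?thesis .
      qed
    qed
  qed
  then show ?thesis by (simp add: num_switches_eq)
qed

section \<open>The solution process\<close>

text \<open>Multiplying a vector field by a scalar cutoff makes it bounded and globally Lipschitz. As the
  factor is nonnegative, the direction of the field is unchanged, so that a function which decreases along
  the original field is still nonincreasing along the new one.\<close>

definition cutoff :: "real \<Rightarrow> 'b::real_normed_vector \<Rightarrow> real" where
  "cutoff R x = max 0 (min 1 (R + 1 - norm x))"

lemma cutoff_bounds: "0 \<le> cutoff R x" "cutoff R x \<le> 1"
  and cutoff_eq_1: "norm x \<le> R \<Longrightarrow> cutoff R x = 1"
  and cutoff_eq_0: "R + 1 \<le> norm x \<Longrightarrow> cutoff R x = 0"
  by (auto simp: cutoff_def)

lemma cutoff_lipschitz: "\<bar>cutoff R x - cutoff R y\<bar> \<le> norm (x - y)"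
  using norm_triangle_ineq3[of x y] unfolding cutoff_def by linarith

lemma cutoff_field_bounded_lipschitz:
  fixes f :: "'b::real_normed_vector \<Rightarrow> 'b"
  assumes R: "0 \<le> R" and "\<exists>L. L-lipschitz_on (cball 0 (R + 1)) f"
  shows "\<exists>B L. \<forall>x y. norm (cutoff R x *\<^sub>R f x) \<le> B \<and>
    norm (cutoff R x *\<^sub>R f x - cutoff R y *\<^sub>R f y) \<le> L * norm (x - y)"
proof -
  obtain L where L: "L-lipschitz_on (cball 0 (R + 1)) f" using assms by blast
  have L0: "0 \<le> L" using L by (rule lipschitz_on_nonneg)
  define B where "B = norm (f 0) + L * (R + 1)"
  have B: "norm (f x) \<le> B" if "norm x \<le> R + 1" for x
  proof -
    have "norm (f x - f 0) \<le> L * norm x"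
      using lipschitz_onD[OF L, of x 0] that R by (simp add: dist_norm)
    also have "\<dots> \<le> L * (R + 1)" using that L0 by (intro mult_left_mono)
    finally show ?thesis using norm_triangle_ineq2[of "f x" "f 0"] by (simp add: B_def)
  qed
  have B0: "0 \<le> B" using R L0 by (simp add: B_def)
  have bound: "norm (cutoff R x *\<^sub>R f x) \<le> B" for x
  proof (cases "norm x \<le> R + 1")
    case True
    have "norm (cutoff R x *\<^sub>R f x) \<le> 1 * B"
      unfolding norm_scaleR using cutoff_bounds[of R x] B[OF True] by (intro mult_mono) auto
    then show ?thesis by simp
  qed (use B0 in \<open>simp add: cutoff_eq_0\<close>)
  have lip: "norm (cutoff R x *\<^sub>R f x - cutoff R y *\<^sub>R f y) \<le> (L + B) * norm (x - y)"
    if y: "norm y \<le> R + 1" for x y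
  proof -
    have 1: "norm (cutoff R x *\<^sub>R (f x - f y)) \<le> L * norm (x - y)"
    proof (cases "norm x \<le> R + 1")
      case True
      have "norm (cutoff R x *\<^sub>R (f x - f y)) \<le> 1 * norm (f x - f y)"
        unfolding norm_scaleR using cutoff_bounds[of R x] by (intro mult_right_mono) auto
      also have "\<dots> \<le> L * norm (x - y)"
        using lipschitz_onD[OF L, of x y] True y by (simp add: dist_norm)
      finally show ?thesis .
    qed (use L0 in \<open>simp add: cutoff_eq_0\<close>)
    have 2: "norm ((cutoff R x - cutoff R y) *\<^sub>R f y) \<le> norm (x - y) * B"
      unfolding norm_scaleR using cutoff_lipschitz B[OF y] by (intro mult_mono) auto
    have "cutoff R x *\<^sub>R f x - cutoff R y *\<^sub>R f y =
        cutoff R x *\<^sub>R (f x - f y) + (cutoff R x - cutoff R y) *\<^sub>R f y"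
      by (simp add: algebra_simps)
    also have "norm \<dots> \<le> L * norm (x - y) + norm (x - y) * B"
      by (rule norm_triangle_mono[OF 1 2])
    finally show ?thesis by (simp add: algebra_simps)
  qed
  have "norm (cutoff R x *\<^sub>R f x - cutoff R y *\<^sub>R f y) \<le> (L + B) * norm (x - y)" for x y
  proof (cases "norm x \<le> R + 1 \<or> norm y \<le> R + 1")
    case True
    then show ?thesis using lip[of y x] lip[of x y] by (metis norm_minus_commute)
  qed (use L0 B0 in \<open>simp add: cutoff_eq_0\<close>)
  with bound show ?thesis by blast
qed

lemma AE_isCont_cadlag:
  fixes s :: "real \<Rightarrow> 'p::discrete_topology"
  assumes "cadlag s"
  shows "AE t in lborel. 0 < t \<longrightarrow> isCont s t"
proof -
  have "countable (\<Union>n::nat. switch_times s 0 (real n))"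
    by (rule countable_UN) (auto intro!: countable_finite finite_switch_times[OF assms])
  then have "AE t in lborel. t \<notin> (\<Union>n::nat. switch_times s 0 (real n))"
    by (intro AE_not_in countable_imp_null_set_lborel)
  then show ?thesis
  proof eventually_elim
    case (elim t)
    obtain n :: nat where "t \<le> real n" using real_arch_simple by blast
    moreover have "t \<notin> switch_times s 0 (real n)" using elim by blast
    ultimately show ?case by (auto simp: switch_times_def)
  qed
qed

lemma num_switches_mono:
  fixes s :: "real \<Rightarrow> 'p::discrete_topology"
  assumes "cadlag s" "t \<le> T"
  shows "num_switches s t \<le> num_switches s T"
  unfolding num_switches_eq using assms
  by (intro card_mono finite_switch_times) (auto simp: switch_times_def)

context
  fixes M :: "'a measure" and \<sigma> :: "real \<Rightarrow> 'a \<Rightarrow> nat" and P :: "nat set"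
    and f :: "nat \<Rightarrow> 'b::euclidean_space \<Rightarrow> 'b"
  assumes meas: "\<And>t. 0 \<le> t \<Longrightarrow> \<sigma> t \<in> M \<rightarrow>\<^sub>M count_space UNIV"
    and cad: "\<And>\<omega>. \<omega> \<in> space M \<Longrightarrow> cadlag (\<lambda>t. \<sigma> t \<omega>)"
    and \<sigma>P: "\<And>\<omega> t. \<omega> \<in> space M \<Longrightarrow> 0 \<le> t \<Longrightarrow> \<sigma> t \<omega> \<in> P"
    and P: "finite P"
    and lip: "\<And>p \<rho>. p \<in> P \<Longrightarrow> \<exists>L. L-lipschitz_on (cball 0 \<rho>) (f p)"
begin

lemma uniform_lipschitz: "\<exists>L. \<forall>p\<in>P. L-lipschitz_on (cball 0 \<rho>) (f p)"
proof -
  obtain L :: "nat \<Rightarrow> real" where L: "\<And>p. p \<in> P \<Longrightarrow> (L p)-lipschitz_on (cball 0 \<rho>) (f p)"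
    using bchoice[of P "\<lambda>p L. L-lipschitz_on (cball 0 \<rho>) (f p)"] lip by blast
  have "L p \<le> (\<Sum>q\<in>P. L q)" if "p \<in> P" for p
    using P that L lipschitz_on_nonneg by (intro member_le_sum) blast+
  then show ?thesis using L by (intro exI[of _ "\<Sum>q\<in>P. L q"]) (blast intro: lipschitz_on_le)
qed

lemma cutoff_system_solution:
  assumes R: "0 \<le> R"
  shows "\<exists>Y. (\<lambda>(\<omega>, t). Y \<omega> t) \<in> borel_measurable (M \<Otimes>\<^sub>M borel) \<and>
    (\<forall>\<omega>\<in>space M. Y \<omega> 0 = x\<^sub>0 \<and> (\<exists>B. B-lipschitz_on {0..} (Y \<omega>)) \<and>
      (\<forall>t>0. isCont (\<lambda>t. \<sigma> t \<omega>) t \<longrightarrow>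
        (Y \<omega> has_vector_derivative cutoff R (Y \<omega> t) *\<^sub>R f (\<sigma> t \<omega>) (Y \<omega> t)) (at t)))"
proof -
  define g where "g p x = (if p \<in> P then cutoff R x *\<^sub>R f p x else 0)" for p x
  have "\<exists>B L. \<forall>x y. norm (g p x) \<le> B \<and> norm (g p x - g p y) \<le> L * norm (x - y)" for p
  proof (cases "p \<in> P")
    case True
    then show ?thesis using cutoff_field_bounded_lipschitz[OF R lip[OF True]] by (simp add: g_def)
  next
    case False
    then show ?thesis by (intro exI[of _ 0]) (simp add: g_def)
  qed
  then obtain B L where BL: "\<And>p x. norm (g p x) \<le> B p"
    "\<And>p x y. norm (g p x - g p y) \<le> L p * norm (x - y)" by metis
  define B' where "B' = (\<Sum>p\<in>P. \<bar>B p\<bar>)"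
  define L' where "L' = 1 + (\<Sum>p\<in>P. \<bar>L p\<bar>)"
  have B': "norm (g p x) \<le> B'" if "p \<in> P" for p x
  proof -
    have "\<bar>B p\<bar> \<le> B'" unfolding B'_def using P that by (intro member_le_sum) auto
    then show ?thesis using BL(1)[of p x] by linarith
  qed
  have L': "norm (g p x - g p y) \<le> L' * norm (x - y)" if "p \<in> P" for p x y
  proof -
    have "\<bar>L p\<bar> \<le> (\<Sum>p\<in>P. \<bar>L p\<bar>)" using P that by (intro member_le_sum) auto
    then have "L p * norm (x - y) \<le> L' * norm (x - y)"
      unfolding L'_def by (intro mult_right_mono) auto
    then show ?thesis using BL(2)[of p x y] by linarith
  qed
  have gcont: "continuous_on UNIV (g p)" for p
  proof -
    have "\<bar>L p\<bar>-lipschitz_on UNIV (g p)"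
    proof (rule lipschitz_onI)
      fix x y :: 'b
      have "L p * norm (x - y) \<le> \<bar>L p\<bar> * norm (x - y)" by (intro mult_right_mono) auto
      then show "dist (g p x) (g p y) \<le> \<bar>L p\<bar> * dist x y"
        using BL(2)[of p x y] by (simp add: dist_norm)
    qed simp
    then show ?thesis by (rule lipschitz_on_continuous_on)
  qed
  have "\<exists>Y. (\<lambda>(\<omega>, t). Y \<omega> t) \<in> borel_measurable (M \<Otimes>\<^sub>M borel) \<and>
    (\<forall>\<omega>\<in>space M. \<forall>t\<ge>0. (\<lambda>s. g (\<sigma> (max 0 s) \<omega>) (Y \<omega> s)) integrable_on {0..t} \<and>
      Y \<omega> t = x\<^sub>0 + integral {0..t} (\<lambda>s. g (\<sigma> (max 0 s) \<omega>) (Y \<omega> s)))"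
  proof (rule picard_solution[where h = "\<lambda>\<omega> t. g (\<sigma> (max 0 t) \<omega>)" and B = B' and L = L'])
    fix y :: "'a \<Rightarrow> real \<Rightarrow> 'b" assume y: "(\<lambda>(\<omega>, t). y \<omega> t) \<in> borel_measurable (M \<Otimes>\<^sub>M borel)"
    have "(\<lambda>x. g p ((\<lambda>(\<omega>, t). y \<omega> t) x)) \<in> borel_measurable (M \<Otimes>\<^sub>M borel)" for p
      by (rule measurable_compose[OF y borel_measurable_continuous_onI[OF gcont]])
    from measurable_compose_countable[OF this cadlag_jointly_measurable[OF meas cad]]
    show "(\<lambda>(\<omega>, t). g (\<sigma> (max 0 t) \<omega>) (y \<omega> t)) \<in> borel_measurable (M \<Otimes>\<^sub>M borel)"
      by (simp add: case_prod_beta)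
  next
    show "1 \<le> L'" by (simp add: L'_def sum_nonneg)
  qed (use \<sigma>P in \<open>auto intro!: B' L'\<close>)
  then obtain Y where Y: "(\<lambda>(\<omega>, t). Y \<omega> t) \<in> borel_measurable (M \<Otimes>\<^sub>M borel)"
    "\<And>\<omega> t. \<omega> \<in> space M \<Longrightarrow> 0 \<le> t \<Longrightarrow> (\<lambda>s. g (\<sigma> (max 0 s) \<omega>) (Y \<omega> s)) integrable_on {0..t}"
    "\<And>\<omega> t. \<omega> \<in> space M \<Longrightarrow> 0 \<le> t \<Longrightarrow> Y \<omega> t = x\<^sub>0 + integral {0..t} (\<lambda>s. g (\<sigma> (max 0 s) \<omega>) (Y \<omega> s))"
    by blast
  have Ylip: "B'-lipschitz_on {0..} (Y \<omega>)" if \<omega>: "\<omega> \<in> space M" for \<omega>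
    by (rule integral_curve_lipschitz[OF Y(2)[OF \<omega>] _ Y(3)[OF \<omega>]]) (simp_all add: B' \<sigma>P \<omega>)
  show ?thesis
  proof (intro exI[of _ Y] conjI ballI allI impI Y(1))
    fix \<omega> assume \<omega>: "\<omega> \<in> space M"
    show "Y \<omega> 0 = x\<^sub>0" using Y(3)[OF \<omega>, of 0] by simp
    show "\<exists>B. B-lipschitz_on {0..} (Y \<omega>)" using Ylip[OF \<omega>] by blast
    fix t :: real assume t: "0 < t" and cont: "isCont (\<lambda>t. \<sigma> t \<omega>) t"
    have "eventually (\<lambda>s. \<sigma> s \<omega> = \<sigma> t \<omega>) (nhds t)"
      using cont[unfolded isCont_def tendsto_discrete_iff_eventually_eq]
      by (simp add: eventually_nhds_conv_at)
    moreover have "eventually (\<lambda>s. s \<in> {0<..}) (nhds t)"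
      using t by (intro eventually_nhds_in_open) auto
    ultimately have ev: "eventually (\<lambda>s. g (\<sigma> (max 0 s) \<omega>) (Y \<omega> s) = g (\<sigma> t \<omega>) (Y \<omega> s)) (nhds t)"
      by eventually_elim simp
    have "isCont (Y \<omega>) t"
    proof -
      have "continuous_on {0..} (Y \<omega>)" using Ylip[OF \<omega>] by (rule lipschitz_on_continuous_on)
      then have "continuous_on {0<..} (Y \<omega>)" by (rule continuous_on_subset) auto
      then show ?thesis using t by (simp add: continuous_on_eq_continuous_at)
    qed
    then have "isCont (\<lambda>s. g (\<sigma> t \<omega>) (Y \<omega> s)) t"
      using gcont by (auto intro: continuous_at_compose[unfolded o_def] simp: continuous_on_eq_continuous_at)
    then have "isCont (\<lambda>s. g (\<sigma> (max 0 s) \<omega>) (Y \<omega> s)) t"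
      by (subst isCont_cong[OF ev])
    from integral_curve_has_vector_derivative[OF Y(2)[OF \<omega>] Y(3)[OF \<omega>] t this]
    show "(Y \<omega> has_vector_derivative cutoff R (Y \<omega> t) *\<^sub>R f (\<sigma> t \<omega>) (Y \<omega> t)) (at t)"
      using t \<sigma>P[OF \<omega>, of t] by (simp add: g_def)
  qed
qed

context
  fixes V :: "nat \<Rightarrow> 'b \<Rightarrow> real" and \<alpha>\<^sub>1 :: "real \<Rightarrow> real" and \<mu> c :: real
  assumes V: "\<And>p x. p \<in> P \<Longrightarrow> V p differentiable (at x)"
    and V0: "\<And>p x. p \<in> P \<Longrightarrow> 0 \<le> V p x"
    and V\<alpha>: "\<And>p x. p \<in> P \<Longrightarrow> \<alpha>\<^sub>1 (norm x) \<le> V p x"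
    and \<alpha>\<^sub>1: "filterlim \<alpha>\<^sub>1 at_top at_top"
    and decr: "\<And>p x. p \<in> P \<Longrightarrow> frechet_derivative (V p) (at x) (f p x) \<le> - c * V p x"
    and c: "0 \<le> c"
    and \<mu>: "1 \<le> \<mu>" "\<And>p q x. p \<in> P \<Longrightarrow> q \<in> P \<Longrightarrow> V p x \<le> \<mu> * V q x"
begin

text \<open>The bound \<open>r\<close> does not depend on the cutoff radius \<open>R\<close>: along the truncated field the Lyapunov
  functions do not increase between switches, hence \<open>V\<close> stays below \<open>\<mu> ^ n\<close> times its initial value,
  where \<open>n\<close> is the number of switches up to \<open>T\<close>. Once \<open>R\<close> exceeds \<open>r\<close>, the truncation is
  inactive on \<open>[0, T]\<close>. The radius depends on \<open>\<omega>\<close> through \<open>n\<close>.\<close>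

lemma cutoff_solution_bounded:
  assumes \<omega>: "\<omega> \<in> space M" and T: "0 \<le> T"
  shows "\<exists>r. \<forall>R y. y 0 = x\<^sub>0 \<longrightarrow> continuous_on {0..} y \<longrightarrow>
    (\<forall>t>0. isCont (\<lambda>t. \<sigma> t \<omega>) t \<longrightarrow>
        (y has_vector_derivative cutoff R (y t) *\<^sub>R f (\<sigma> t \<omega>) (y t)) (at t)) \<longrightarrow>
    (\<forall>t\<in>{0..T}. norm (y t) \<le> r)"
proof -
  define K where "K = \<mu> ^ num_switches (\<lambda>t. \<sigma> t \<omega>) T * V (\<sigma> 0 \<omega>) x\<^sub>0"
  have "eventually (\<lambda>r. K < \<alpha>\<^sub>1 r) at_top"
    using \<alpha>\<^sub>1 by (simp add: filterlim_at_top_dense)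
  then obtain r where r: "\<And>s. r \<le> s \<Longrightarrow> K < \<alpha>\<^sub>1 s" by (auto simp: eventually_at_top_linorder)
  show ?thesis
  proof (intro exI[of _ r] allI impI ballI)
    fix R y t assume y0: "y 0 = x\<^sub>0" and cont: "continuous_on {0..} y"
      and der: "\<forall>t>0. isCont (\<lambda>t. \<sigma> t \<omega>) t \<longrightarrow>
        (y has_vector_derivative cutoff R (y t) *\<^sub>R f (\<sigma> t \<omega>) (y t)) (at t)"
      and t: "t \<in> {0..T}"
    have "V (\<sigma> t \<omega>) (y t) \<le> \<mu> ^ num_switches (\<lambda>t. \<sigma> t \<omega>) t * exp (- 0 * t) * V (\<sigma> 0 \<omega>) (y 0)"
    proof (rule multiple_lyapunov_bound[where P = P and g = "\<lambda>p x. cutoff R x *\<^sub>R f p x"])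
      show "cadlag (\<lambda>t. \<sigma> t \<omega>)" using cad[OF \<omega>] .
      show "continuous_on {0..t} y" using cont by (rule continuous_on_subset) auto
      show "frechet_derivative (V p) (at (y s)) (cutoff R (y s) *\<^sub>R f p (y s)) \<le> - 0 * V p (y s)"
        if p: "p \<in> P" for p s
      proof -
        have "frechet_derivative (V p) (at (y s)) (cutoff R (y s) *\<^sub>R f p (y s)) =
            cutoff R (y s) * frechet_derivative (V p) (at (y s)) (f p (y s))"
          using linear_frechet_derivative[OF V[OF p]] by (simp add: linear_cmul)
        also have "\<dots> \<le> 0"
        proof (rule mult_nonneg_nonpos)
          have "0 \<le> c * V p (y s)" using c V0[OF p] by simp
          then show "frechet_derivative (V p) (at (y s)) (f p (y s)) \<le> 0"
            using decr[OF p, of "y s"] by simp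
        qed (rule cutoff_bounds)
        finally show ?thesis by simp
      qed
      show "(y has_vector_derivative cutoff R (y s) *\<^sub>R f (\<sigma> s \<omega>) (y s)) (at s)"
        if "0 < s" "isCont (\<lambda>t. \<sigma> t \<omega>) s" for s
        using der that by blast
      show "0 \<le> t" using t by simp
    qed ((rule V V0 \<mu> \<sigma>P[OF \<omega>]; assumption) | rule \<mu>(1))+
    also have "\<dots> = \<mu> ^ num_switches (\<lambda>t. \<sigma> t \<omega>) t * V (\<sigma> 0 \<omega>) x\<^sub>0" by (simp add: y0)
    also have "\<dots> \<le> K"
      unfolding K_def using \<mu>(1) t num_switches_mono[OF cad[OF \<omega>], of t T] V0 \<sigma>P[OF \<omega>]
      by (intro mult_right_mono power_increasing) auto
    finally have "\<alpha>\<^sub>1 (norm (y t)) \<le> K"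
      using V\<alpha>[OF \<sigma>P[OF \<omega>, of t], of "y t"] t by simp
    then show "norm (y t) \<le> r" using r[of "norm (y t)"] by linarith
  qed
qed

text \<open>For each \<open>\<omega>\<close> and \<open>T\<close> the truncated solutions with integer radius coincide on \<open>[0, T]\<close> from some
  radius on, by uniqueness. Their pointwise limit therefore solves the original system, and it
  is measurable as a limit of measurable functions although the radius depends on \<open>\<omega>\<close>.\<close>

lemma solution_process_exists:
  "\<exists>X. solution_process M f \<sigma> X \<and>
    (\<forall>x\<^sub>0. \<forall>\<omega>\<in>space M. \<forall>t\<ge>0. V (\<sigma> t \<omega>) (X x\<^sub>0 t \<omega>)
      \<le> \<mu> ^ num_switches (\<lambda>u. \<sigma> u \<omega>) t * exp (- c * t) * V (\<sigma> 0 \<omega>) x\<^sub>0)"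
proof -
  define Q where "Q R x\<^sub>0 Y \<longleftrightarrow> (\<lambda>(\<omega>, t). Y \<omega> t) \<in> borel_measurable (M \<Otimes>\<^sub>M borel) \<and>
    (\<forall>\<omega>\<in>space M. Y \<omega> 0 = x\<^sub>0 \<and> (\<exists>B. B-lipschitz_on {0..} (Y \<omega>)) \<and>
      (\<forall>t>0. isCont (\<lambda>t. \<sigma> t \<omega>) t \<longrightarrow>
        (Y \<omega> has_vector_derivative cutoff (real R) (Y \<omega> t) *\<^sub>R f (\<sigma> t \<omega>) (Y \<omega> t)) (at t)))"
    for R :: nat and x\<^sub>0 and Y :: "'a \<Rightarrow> real \<Rightarrow> 'b"
  define Y where "Y R x\<^sub>0 = (SOME y. Q R x\<^sub>0 y)" for R x\<^sub>0
  have QY: "Q R x\<^sub>0 (Y R x\<^sub>0)" for R x\<^sub>0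
  proof -
    have "\<exists>y. Q R x\<^sub>0 y" unfolding Q_def by (rule cutoff_system_solution) simp
    then show ?thesis unfolding Y_def by (rule someI_ex)
  qed
  have Y_meas: "(\<lambda>(\<omega>, t). Y R x\<^sub>0 \<omega> t) \<in> borel_measurable (M \<Otimes>\<^sub>M borel)" for R x\<^sub>0
    using QY[of R x\<^sub>0] by (simp add: Q_def)
  have Y_0: "Y R x\<^sub>0 \<omega> 0 = x\<^sub>0" if "\<omega> \<in> space M" for R x\<^sub>0 \<omega>
    using QY[of R x\<^sub>0] that by (simp add: Q_def)
  have Y_lip: "\<exists>B. B-lipschitz_on {0..} (Y R x\<^sub>0 \<omega>)" if "\<omega> \<in> space M" for R x\<^sub>0 \<omega>
    using QY[of R x\<^sub>0] that by (simp add: Q_def)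
  have Y_cont: "continuous_on {0..} (Y R x\<^sub>0 \<omega>)" if "\<omega> \<in> space M" for R x\<^sub>0 \<omega>
    using Y_lip[OF that] lipschitz_on_continuous_on by blast
  have Y_der: "(Y R x\<^sub>0 \<omega> has_vector_derivative cutoff (real R) (Y R x\<^sub>0 \<omega> t) *\<^sub>R f (\<sigma> t \<omega>) (Y R x\<^sub>0 \<omega> t)) (at t)"
    if "\<omega> \<in> space M" "0 < t" "isCont (\<lambda>t. \<sigma> t \<omega>) t" for R x\<^sub>0 \<omega> t
    using QY[of R x\<^sub>0] that by (simp add: Q_def)
  have Y_ac: "absolutely_continuous_interval 0 T (Y R x\<^sub>0 \<omega>)" if "\<omega> \<in> space M" for R x\<^sub>0 \<omega> T
  proof -
    obtain B where "B-lipschitz_on {0..} (Y R x\<^sub>0 \<omega>)" using Y_lip[OF \<open>\<omega> \<in> space M\<close>] by blast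
    then have "B-lipschitz_on {0..T} (Y R x\<^sub>0 \<omega>)" by (rule lipschitz_on_subset) auto
    then show ?thesis by (rule lipschitz_on_imp_absolutely_continuous_interval)
  qed
  define X where "X x\<^sub>0 t \<omega> = lim (\<lambda>R. Y R x\<^sub>0 \<omega> t)" for x\<^sub>0 t \<omega>
  have X: "\<exists>R. (\<forall>t\<in>{0..T}. X x\<^sub>0 t \<omega> = Y R x\<^sub>0 \<omega> t) \<and>
      (\<forall>t. 0 < t \<longrightarrow> t \<le> T \<longrightarrow> isCont (\<lambda>t. \<sigma> t \<omega>) t \<longrightarrow>
        (Y R x\<^sub>0 \<omega> has_vector_derivative f (\<sigma> t \<omega>) (Y R x\<^sub>0 \<omega> t)) (at t))"
    if \<omega>: "\<omega> \<in> space M" and T: "0 \<le> T" for x\<^sub>0 \<omega> T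
  proof -
    obtain r where r: "\<And>R t. t \<in> {0..T} \<Longrightarrow> norm (Y R x\<^sub>0 \<omega> t) \<le> r"
      using cutoff_solution_bounded[OF \<omega> T, of x\<^sub>0] Y_0[OF \<omega>] Y_cont[OF \<omega>] Y_der[OF \<omega>] by metis
    obtain R0 :: nat where R0: "r \<le> real R0" using real_arch_simple by blast
    have der: "(Y R x\<^sub>0 \<omega> has_vector_derivative f (\<sigma> t \<omega>) (Y R x\<^sub>0 \<omega> t)) (at t)"
      if "R0 \<le> R" "0 < t" "t \<le> T" "isCont (\<lambda>t. \<sigma> t \<omega>) t" for R t
    proof -
      have "norm (Y R x\<^sub>0 \<omega> t) \<le> real R" using r[of t R] R0 that by simp
      then show ?thesis using Y_der[OF \<omega> that(2,4), of R x\<^sub>0] by (simp add: cutoff_eq_1)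
    qed
    have eq: "Y R x\<^sub>0 \<omega> t = Y R0 x\<^sub>0 \<omega> t" if R: "R0 \<le> R" and t: "t \<in> {0..T}" for R t
    proof (rule caratheodory_unique[OF uniform_lipschitz, where T = T and s = "\<lambda>t. \<sigma> t \<omega>"])
      show "AE t in lborel. 0 < t \<and> t < T \<longrightarrow>
          (Y R x\<^sub>0 \<omega> has_vector_derivative f (\<sigma> t \<omega>) (Y R x\<^sub>0 \<omega> t)) (at t)"
        using AE_isCont_cadlag[OF cad[OF \<omega>]] by eventually_elim (use der[OF R] in auto)
      show "AE t in lborel. 0 < t \<and> t < T \<longrightarrow>
          (Y R0 x\<^sub>0 \<omega> has_vector_derivative f (\<sigma> t \<omega>) (Y R0 x\<^sub>0 \<omega> t)) (at t)"
        using AE_isCont_cadlag[OF cad[OF \<omega>]] by eventually_elim (use der[OF order.refl] in auto)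
      show "Y R x\<^sub>0 \<omega> 0 = Y R0 x\<^sub>0 \<omega> 0" by (simp only: Y_0[OF \<omega>])
    qed (use \<sigma>P[OF \<omega>] t in \<open>auto intro!: Y_ac[OF \<omega>]\<close>)
    have "X x\<^sub>0 t \<omega> = Y R0 x\<^sub>0 \<omega> t" if t: "t \<in> {0..T}" for t
    proof -
      have "eventually (\<lambda>R. Y R x\<^sub>0 \<omega> t = Y R0 x\<^sub>0 \<omega> t) sequentially"
        using eventually_ge_at_top[of R0] by eventually_elim (rule eq[OF _ t])
      then show ?thesis unfolding X_def by (rule limI[OF tendsto_eventually])
    qed
    then show ?thesis using der[OF order.refl] by blast
  qed
  have "caratheodory_solution f (\<lambda>t. \<sigma> t \<omega>) x\<^sub>0 y \<longleftrightarrow> (\<forall>t\<ge>0. y t = X x\<^sub>0 t \<omega>)"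
    if \<omega>: "\<omega> \<in> space M" for x\<^sub>0 \<omega> y
  proof
    assume y: "caratheodory_solution f (\<lambda>t. \<sigma> t \<omega>) x\<^sub>0 y"
    show "\<forall>t\<ge>0. y t = X x\<^sub>0 t \<omega>"
    proof (intro allI impI)
      fix T :: real assume T: "0 \<le> T"
      obtain R where R: "\<And>t. t \<in> {0..T} \<Longrightarrow> X x\<^sub>0 t \<omega> = Y R x\<^sub>0 \<omega> t"
        "\<And>t. 0 < t \<Longrightarrow> t \<le> T \<Longrightarrow> isCont (\<lambda>t. \<sigma> t \<omega>) t \<Longrightarrow>
          (Y R x\<^sub>0 \<omega> has_vector_derivative f (\<sigma> t \<omega>) (Y R x\<^sub>0 \<omega> t)) (at t)"
        using X[OF \<omega> T, of x\<^sub>0] by blast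
      have "y T = Y R x\<^sub>0 \<omega> T"
      proof (rule caratheodory_unique[OF uniform_lipschitz, where T = T and s = "\<lambda>t. \<sigma> t \<omega>"])
        have "AE t in lborel. 0 < t \<longrightarrow> (y has_vector_derivative f (\<sigma> t \<omega>) (y t)) (at t)"
          using y by (simp add: caratheodory_solution_def)
        then show "AE t in lborel. 0 < t \<and> t < T \<longrightarrow> (y has_vector_derivative f (\<sigma> t \<omega>) (y t)) (at t)"
          by eventually_elim simp
        show "AE t in lborel. 0 < t \<and> t < T \<longrightarrow>
            (Y R x\<^sub>0 \<omega> has_vector_derivative f (\<sigma> t \<omega>) (Y R x\<^sub>0 \<omega> t)) (at t)"
          using AE_isCont_cadlag[OF cad[OF \<omega>]] by eventually_elim (use R(2) in auto)
        show "absolutely_continuous_interval 0 T y" "y 0 = Y R x\<^sub>0 \<omega> 0"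
          using y T Y_0[OF \<omega>] by (simp_all add: caratheodory_solution_def)
      qed (use \<sigma>P[OF \<omega>] T in \<open>auto intro!: Y_ac[OF \<omega>]\<close>)
      then show "y T = X x\<^sub>0 T \<omega>" using R(1)[of T] T by simp
    qed
  next
    assume y: "\<forall>t\<ge>0. y t = X x\<^sub>0 t \<omega>"
    have yR: "\<exists>R. (\<forall>t\<in>{0..T}. Y R x\<^sub>0 \<omega> t = y t) \<and>
      (\<forall>t. 0 < t \<longrightarrow> t \<le> T \<longrightarrow> isCont (\<lambda>t. \<sigma> t \<omega>) t \<longrightarrow>
        (Y R x\<^sub>0 \<omega> has_vector_derivative f (\<sigma> t \<omega>) (Y R x\<^sub>0 \<omega> t)) (at t))" if "0 \<le> T" for T
      using X[OF \<omega> that, of x\<^sub>0] y by auto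
    show "caratheodory_solution f (\<lambda>t. \<sigma> t \<omega>) x\<^sub>0 y"
      unfolding caratheodory_solution_def
    proof (intro conjI allI impI)
      obtain R where "\<forall>t\<in>{0..0}. Y R x\<^sub>0 \<omega> t = y t" using yR[OF order.refl] by blast
      then show "y 0 = x\<^sub>0" using Y_0[OF \<omega>] by simp
    next
      fix T :: real assume "0 \<le> T"
      then obtain R where "\<forall>t\<in>{0..T}. Y R x\<^sub>0 \<omega> t = y t" using yR by blast
      then show "absolutely_continuous_interval 0 T y"
        by (intro absolutely_continuous_interval_cong[OF Y_ac[OF \<omega>, of T R x\<^sub>0]]) auto
    next
      show "AE t in lborel. 0 < t \<longrightarrow> (y has_vector_derivative f (\<sigma> t \<omega>) (y t)) (at t)"
        using AE_isCont_cadlag[OF cad[OF \<omega>]]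
      proof (eventually_elim, intro impI)
        fix t :: real assume "0 < t \<longrightarrow> isCont (\<lambda>t. \<sigma> t \<omega>) t" and t: "0 < t"
        moreover obtain R where R: "\<forall>s\<in>{0..t + 1}. Y R x\<^sub>0 \<omega> s = y s"
          "\<forall>s. 0 < s \<longrightarrow> s \<le> t + 1 \<longrightarrow> isCont (\<lambda>t. \<sigma> t \<omega>) s \<longrightarrow>
            (Y R x\<^sub>0 \<omega> has_vector_derivative f (\<sigma> s \<omega>) (Y R x\<^sub>0 \<omega> s)) (at s)"
          using yR[of "t + 1"] t by auto
        ultimately have "(Y R x\<^sub>0 \<omega> has_vector_derivative f (\<sigma> t \<omega>) (y t)) (at t)" by simp
        then show "(y has_vector_derivative f (\<sigma> t \<omega>) (y t)) (at t)"
          by (rule has_vector_derivative_transform_within_open[where S = "{0<..<t + 1}"]) (use t R in auto)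
      qed
    qed
  qed
  moreover have "X x\<^sub>0 t \<in> borel_measurable M" for x\<^sub>0 t
  proof -
    have "(\<lambda>\<omega>. Y R x\<^sub>0 \<omega> t) \<in> borel_measurable M" for R
      using measurable_compose[OF measurable_Pair2' Y_meas[of R x\<^sub>0], of t] by simp
    then show ?thesis unfolding X_def[abs_def] by (rule borel_measurable_lim_metric)
  qed
  ultimately have "solution_process M f \<sigma> X" by (simp add: solution_process_def)
  moreover have "V (\<sigma> T \<omega>) (X x\<^sub>0 T \<omega>)
      \<le> \<mu> ^ num_switches (\<lambda>u. \<sigma> u \<omega>) T * exp (- c * T) * V (\<sigma> 0 \<omega>) x\<^sub>0"
    if \<omega>: "\<omega> \<in> space M" and T: "0 \<le> T" for x\<^sub>0 \<omega> T
  proof -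
    obtain R where R: "\<And>t. t \<in> {0..T} \<Longrightarrow> X x\<^sub>0 t \<omega> = Y R x\<^sub>0 \<omega> t"
        "\<And>t. 0 < t \<Longrightarrow> t \<le> T \<Longrightarrow> isCont (\<lambda>t. \<sigma> t \<omega>) t \<Longrightarrow>
          (Y R x\<^sub>0 \<omega> has_vector_derivative f (\<sigma> t \<omega>) (Y R x\<^sub>0 \<omega> t)) (at t)"
        using X[OF \<omega> T, of x\<^sub>0] by blast
    have "V (\<sigma> T \<omega>) (Y R x\<^sub>0 \<omega> T)
      \<le> \<mu> ^ num_switches (\<lambda>u. \<sigma> u \<omega>) T * exp (- c * T) * V (\<sigma> 0 \<omega>) (Y R x\<^sub>0 \<omega> 0)"
    proof (rule multiple_lyapunov_bound[where P = P and g = f])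
      show "continuous_on {0..T} (Y R x\<^sub>0 \<omega>)" using Y_cont[OF \<omega>] by (rule continuous_on_subset) auto
      show "(Y R x\<^sub>0 \<omega> has_vector_derivative f (\<sigma> s \<omega>) (Y R x\<^sub>0 \<omega> s)) (at s)"
        if "0 < s" "s < T" "isCont (\<lambda>t. \<sigma> t \<omega>) s" for s
        using R(2)[of s] that by simp
    qed ((rule cad[OF \<omega>] V V0 \<mu> decr \<sigma>P[OF \<omega>]; assumption) | rule \<mu>(1) T)+
    then show ?thesis using R(1)[of T] T Y_0[OF \<omega>] by simp
  qed
  ultimately show ?thesis by blast
qed

end

end

section \<open>From bounds in expectation to stability in the mean\<close>

text \<open>The moment generating function of a counting variable: the terms with \<open>k \<ge> m\<close> are dominated by
  the exponential series of \<open>\<mu> * a\<close>, the finitely many others by \<open>\<mu> ^ k\<close>.\<close>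

lemma nn_integral_power_le:
  fixes N :: "'a \<Rightarrow> nat" and \<mu> a e :: real
  assumes M: "finite_measure M" "emeasure M (space M) \<le> 1"
    and [measurable]: "N \<in> M \<rightarrow>\<^sub>M count_space UNIV"
    and \<mu>: "0 \<le> \<mu>" and a: "0 \<le> a" "0 \<le> e"
    and tail: "\<And>k. m \<le> k \<Longrightarrow> measure M {\<omega> \<in> space M. N \<omega> = k} \<le> a ^ k * e / fact k"
  shows "(\<integral>\<^sup>+\<omega>. ennreal (\<mu> ^ N \<omega>) \<partial>M) \<le> ennreal ((\<Sum>k<m. \<mu> ^ k) + e * exp (\<mu> * a))"
proof -
  interpret finite_measure M by fact
  define A where "A k = {\<omega> \<in> space M. N \<omega> = k}" for k
  have A[measurable]: "A k \<in> sets M" for k unfolding A_def by measurable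
  define b where "b k = (if k < m then \<mu> ^ k else 0) + e * ((\<mu> * a) ^ k / fact k)" for k
  have b0: "0 \<le> b k" for k using \<mu> a by (simp add: b_def)
  have b: "b sums ((\<Sum>k<m. \<mu> ^ k) + e * exp (\<mu> * a))"
  proof -
    have "(\<lambda>k. if k \<in> {..<m} then \<mu> ^ k else 0) sums (\<Sum>k<m. \<mu> ^ k)"
      by (rule sums_If_finite_set) simp
    moreover have "(\<lambda>k. e * ((\<mu> * a) ^ k / fact k)) sums (e * exp (\<mu> * a))"
      using exp_converges[of "\<mu> * a"] by (intro sums_mult) (simp add: divide_inverse_commute)
    ultimately show ?thesis unfolding b_def by (intro sums_add) simp_all
  qed
  have "(\<integral>\<^sup>+\<omega>. ennreal (\<mu> ^ N \<omega>) \<partial>M) = (\<integral>\<^sup>+\<omega>. (\<Sum>k. ennreal (\<mu> ^ k) * indicator (A k) \<omega>) \<partial>M)"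
  proof (rule nn_integral_cong)
    fix \<omega> assume "\<omega> \<in> space M"
    then have "\<omega> \<in> A (N \<omega>)" by (simp add: A_def)
    moreover have "disjoint_family A" by (auto simp: disjoint_family_on_def A_def)
    ultimately show "ennreal (\<mu> ^ N \<omega>) = (\<Sum>k. ennreal (\<mu> ^ k) * indicator (A k) \<omega>)"
      using suminf_cmult_indicator[of A \<omega> "N \<omega>" "\<lambda>k. ennreal (\<mu> ^ k)"] by simp
  qed
  also have "\<dots> = (\<Sum>k. ennreal (\<mu> ^ k) * emeasure M (A k))"
    by (subst nn_integral_suminf) (simp_all add: nn_integral_cmult_indicator)
  also have "\<dots> \<le> (\<Sum>k. ennreal (b k))"
  proof (rule suminf_le)
    fix k
    show "ennreal (\<mu> ^ k) * emeasure M (A k) \<le> ennreal (b k)"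
    proof (cases "k < m")
      case True
      have "emeasure M (A k) \<le> 1"
        using emeasure_space[of M "A k"] M(2) by (rule order.trans)
      then have "ennreal (\<mu> ^ k) * emeasure M (A k) \<le> ennreal (\<mu> ^ k) * 1"
        by (rule mult_left_mono) simp
      also have "\<dots> \<le> ennreal (b k)" using True \<mu> a by (simp add: b_def ennreal_leI)
      finally show ?thesis .
    next
      case False
      then have "measure M (A k) \<le> a ^ k * e / fact k" using tail[of k] by (simp add: A_def)
      then have "\<mu> ^ k * measure M (A k) \<le> \<mu> ^ k * (a ^ k * e / fact k)"
        using \<mu> by (intro mult_left_mono) auto
      also have "\<dots> = b k" using False by (simp add: b_def power_mult_distrib)
      finally have "\<mu> ^ k * measure M (A k) \<le> b k" .
      then show ?thesis
        unfolding emeasure_eq_measure using \<mu> by (simp add: ennreal_mult[symmetric] ennreal_leI)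
    qed
  qed auto
  also have "\<dots> = ennreal ((\<Sum>k<m. \<mu> ^ k) + e * exp (\<mu> * a))"
    by (simp only: suminf_ennreal2[OF b0 sums_summable[OF b]] sums_unique[OF b, symmetric])
  finally show ?thesis .
qed

lemma gas_in_mean_of_exponential_bound:
  fixes X :: "'b::real_normed_vector \<Rightarrow> real \<Rightarrow> 'a \<Rightarrow> 'b"
  assumes \<alpha>: "class_K \<alpha>" and C: "0 \<le> C" and \<kappa>: "0 < \<kappa>"
    and bound: "\<And>x\<^sub>0 t. 0 \<le> t \<Longrightarrow>
      (\<integral>\<^sup>+\<omega>. ennreal (\<phi> (norm (X x\<^sub>0 t \<omega>))) \<partial>M) \<le> ennreal (C * exp (- \<kappa> * t) * \<alpha> (norm x\<^sub>0))"
  shows "gas_in_mean_of \<phi> M X"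
proof -
  have \<alpha>0: "\<alpha> 0 = 0" and \<alpha>_nonneg: "\<And>r. 0 \<le> r \<Longrightarrow> 0 \<le> \<alpha> r"
    and \<alpha>_mono: "\<And>r s. 0 \<le> r \<Longrightarrow> r \<le> s \<Longrightarrow> \<alpha> r \<le> \<alpha> s"
    and \<alpha>_cont: "continuous_on {0..} \<alpha>"
    using \<alpha> by (auto simp: class_K_def intro: strict_mono_on_leD)
  have near_0: thesis if "0 < e" and *: "\<And>\<delta>. 0 < \<delta> \<Longrightarrow> (\<And>r. 0 \<le> r \<Longrightarrow> r < \<delta> \<Longrightarrow> \<alpha> r < e) \<Longrightarrow> thesis"
    for e thesis
  proof -
    obtain \<delta> where \<delta>: "0 < \<delta>" "\<And>r. r \<in> {0..} \<Longrightarrow> dist r 0 < \<delta> \<Longrightarrow> dist (\<alpha> r) (\<alpha> 0) < e"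
      using \<alpha>_cont[unfolded continuous_on_iff, rule_format, of 0 e] \<open>0 < e\<close> by auto
    show thesis
    proof (rule *[OF \<delta>(1)])
      fix r assume "0 \<le> r" "r < \<delta>"
      then show "\<alpha> r < e" using \<delta>(2)[of r] \<alpha>0 by (simp add: dist_real_def)
    qed
  qed
  have SUP_less: "(SUP t\<in>T. g t) < ennreal \<epsilon>"
    if "0 < \<epsilon>" "\<And>t. t \<in> T \<Longrightarrow> g t \<le> ennreal (\<epsilon> / 2)" for \<epsilon> :: real and g and T :: "real set"
  proof -
    have "(SUP t\<in>T. g t) \<le> ennreal (\<epsilon> / 2)" using that(2) by (rule SUP_least)
    also have "\<dots> < ennreal \<epsilon>" using that(1) by (simp add: ennreal_less_iff)
    finally show ?thesis .
  qed
  show ?thesis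
    unfolding gas_in_mean_of_def
  proof (intro conjI allI impI)
    fix \<epsilon> :: real assume \<epsilon>: "0 < \<epsilon>"
    have "0 < \<epsilon> / (2 * (C + 1))" using \<epsilon> C by simp
    then obtain \<delta> where \<delta>: "0 < \<delta>" "\<And>r. 0 \<le> r \<Longrightarrow> r < \<delta> \<Longrightarrow> \<alpha> r < \<epsilon> / (2 * (C + 1))"
      by (rule near_0) (rule that)
    show "\<exists>\<delta>>0. \<forall>x\<^sub>0. norm x\<^sub>0 < \<delta> \<longrightarrow>
        (SUP t\<in>{0..}. \<integral>\<^sup>+\<omega>. ennreal (\<phi> (norm (X x\<^sub>0 t \<omega>))) \<partial>M) < ennreal \<epsilon>"
    proof (intro exI[of _ \<delta>] conjI allI impI \<delta>(1) SUP_less[OF \<epsilon>])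
      fix x\<^sub>0 :: 'b and t :: real assume x: "norm x\<^sub>0 < \<delta>" and t: "t \<in> {0..}"
      have "C * exp (- \<kappa> * t) * \<alpha> (norm x\<^sub>0) \<le> (C + 1) * 1 * (\<epsilon> / (2 * (C + 1)))"
        using \<delta>(2)[of "norm x\<^sub>0"] x C \<kappa> t \<alpha>_nonneg[of "norm x\<^sub>0"] by (intro mult_mono) auto
      also have "\<dots> = \<epsilon> / 2" using C by (simp add: field_simps)
      finally show "(\<integral>\<^sup>+\<omega>. ennreal (\<phi> (norm (X x\<^sub>0 t \<omega>))) \<partial>M) \<le> ennreal (\<epsilon> / 2)"
        using t by (intro order.trans[OF bound] ennreal_leI) auto
    qed
  next
    fix r \<epsilon> :: real assume r: "0 < r" and \<epsilon>: "0 < \<epsilon>"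
    define D where "D = C * \<alpha> r"
    have D: "0 \<le> D" using C \<alpha>_nonneg r by (simp add: D_def)
    \<comment> \<open>Chosen such that \<open>D \<le> \<epsilon> / 2 * (1 + \<kappa> * T)\<close>, which suffices because \<open>1 + x \<le> exp x\<close>.\<close>
    define T where "T = 2 * D / (\<epsilon> * \<kappa>)"
    have T: "0 \<le> T" using D \<epsilon> \<kappa> by (simp add: T_def)
    have DT: "exp (- \<kappa> * t) * D \<le> \<epsilon> / 2" if "T \<le> t" for t
    proof -
      have "D \<le> \<epsilon> / 2 * (1 + \<kappa> * T)" using \<epsilon> \<kappa> by (simp add: T_def field_simps)
      also have "\<dots> \<le> \<epsilon> / 2 * exp (\<kappa> * T)" using \<epsilon> by (intro mult_left_mono exp_ge_add_one_self) auto
      also have "\<dots> \<le> \<epsilon> / 2 * exp (\<kappa> * t)" using \<epsilon> \<kappa> that by simp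
      finally have "exp (- \<kappa> * t) * D \<le> exp (- \<kappa> * t) * (\<epsilon> / 2 * exp (\<kappa> * t))"
        by (intro mult_left_mono) auto
      also have "\<dots> = \<epsilon> / 2" by (simp add: exp_minus field_simps)
      finally show ?thesis .
    qed
    show "\<exists>T\<ge>0. \<forall>x\<^sub>0. norm x\<^sub>0 < r \<longrightarrow>
        (SUP t\<in>{T..}. \<integral>\<^sup>+\<omega>. ennreal (\<phi> (norm (X x\<^sub>0 t \<omega>))) \<partial>M) < ennreal \<epsilon>"
    proof (intro exI[of _ T] conjI allI impI T SUP_less[OF \<epsilon>])
      fix x\<^sub>0 :: 'b and t :: real assume x: "norm x\<^sub>0 < r" and t: "t \<in> {T..}"
      have "C * exp (- \<kappa> * t) * \<alpha> (norm x\<^sub>0) \<le> C * exp (- \<kappa> * t) * \<alpha> r"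
        using x C by (intro mult_left_mono \<alpha>_mono) auto
      also have "\<dots> = exp (- \<kappa> * t) * D" by (simp add: D_def)
      also have "\<dots> \<le> \<epsilon> / 2" using DT t by simp
      finally show "(\<integral>\<^sup>+\<omega>. ennreal (\<phi> (norm (X x\<^sub>0 t \<omega>))) \<partial>M) \<le> ennreal (\<epsilon> / 2)"
        using t T by (intro order.trans[OF bound] ennreal_leI) auto
    qed
  qed
qed

lemma class_K_pos:
  assumes "class_K \<alpha>" "0 < r"
  shows "0 < \<alpha> r"
proof -
  have "strict_mono_on {0..} \<alpha>" "\<alpha> 0 = 0" using assms(1) by (simp_all add: class_K_def)
  from strict_mono_onD[OF this(1), of 0 r] this(2) assms(2) show ?thesis by simp
qed

text \<open>A convex function that vanishes at \<open>0\<close> lies, beyond \<open>\<rho>\<close>, above the line through the origin and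
  \<open>(\<rho>, \<alpha> \<rho>)\<close>.\<close>

lemma convex_linear_bound:
  fixes \<alpha> :: "real \<Rightarrow> real"
  assumes \<alpha>: "class_K \<alpha>" and conv: "convex_on {0..} \<alpha>" and \<rho>: "0 < \<rho>" and s: "0 \<le> s"
  shows "s \<le> \<rho> + \<rho> / \<alpha> \<rho> * \<alpha> s"
proof -
  have pos: "0 < \<alpha> \<rho>" and s0: "0 \<le> \<alpha> s" and zero: "\<alpha> 0 = 0"
    using class_K_pos[OF \<alpha> \<rho>] \<alpha> s by (auto simp: class_K_def)
  show ?thesis
  proof (cases "s \<le> \<rho>")
    case True
    then show ?thesis using pos s0 \<rho> by (simp add: add_increasing2)
  next
    case False
    then have "0 < s" "\<rho> / s \<le> 1" using \<rho> by auto
    have "\<alpha> ((1 - \<rho> / s) *\<^sub>R 0 + (\<rho> / s) *\<^sub>R s) \<le> (1 - \<rho> / s) * \<alpha> 0 + \<rho> / s * \<alpha> s"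
      using conv \<rho> s \<open>\<rho> / s \<le> 1\<close> by (intro convex_onD) auto
    then have "\<alpha> \<rho> \<le> \<rho> / s * \<alpha> s" using zero \<open>0 < s\<close> by simp
    then have "s \<le> \<rho> / \<alpha> \<rho> * \<alpha> s" using \<open>0 < s\<close> pos by (simp add: field_simps)
    then show ?thesis using \<rho> by simp
  qed
qed

text \<open>The linear bound with \<open>\<rho> = \<epsilon> / 4\<close> turns a mean of \<open>\<alpha> (norm (X x\<^sub>0 t \<omega>))\<close> below \<open>\<alpha> (\<epsilon> / 4)\<close> into a mean
  of \<open>norm (X x\<^sub>0 t \<omega>)\<close> of at most \<open>\<epsilon> / 2\<close>. This replaces Jensen's inequality together with
  the inverse of \<open>\<alpha>\<close>.\<close>

lemma gas_in_mean_of_convex_imp_gas_in_mean: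
  fixes X :: "'b::euclidean_space \<Rightarrow> real \<Rightarrow> 'a \<Rightarrow> 'b"
  assumes M: "emeasure M (space M) \<le> 1" and \<alpha>: "class_K \<alpha>" and conv: "convex_on {0..} \<alpha>"
    and X: "\<And>x\<^sub>0 t. 0 \<le> t \<Longrightarrow> X x\<^sub>0 t \<in> borel_measurable M"
    and gas: "gas_in_mean_of \<alpha> M X"
  shows "gas_in_mean M X"
proof -
  define I where "I \<phi> x\<^sub>0 t = (\<integral>\<^sup>+\<omega>. ennreal (\<phi> (norm (X x\<^sub>0 t \<omega>))) \<partial>M)" for \<phi> :: "real \<Rightarrow> real" and x\<^sub>0 t
  have \<alpha>_nonneg: "0 \<le> \<alpha> r" if "0 \<le> r" for r using \<alpha> that by (auto simp: class_K_def)
  have \<alpha>_pos: "0 < \<alpha> r" if "0 < r" for r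
    using \<alpha> that by (rule class_K_pos)
  have transfer: "(SUP t\<in>T. I (\<lambda>r. r) x\<^sub>0 t) < ennreal \<epsilon>"
    if \<epsilon>: "0 < \<epsilon>" and T: "T \<subseteq> {0..}"
      and less: "(SUP t\<in>T. I \<alpha> x\<^sub>0 t) < ennreal (\<alpha> (\<epsilon> / 4))" for \<epsilon> x\<^sub>0 and T :: "real set"
  proof -
    define c where "c = (\<epsilon> / 4) / \<alpha> (\<epsilon> / 4)"
    have c: "0 \<le> c" "c * \<alpha> (\<epsilon> / 4) = \<epsilon> / 4" using \<epsilon> \<alpha>_pos[of "\<epsilon> / 4"] by (auto simp: c_def)
    have "I (\<lambda>r. r) x\<^sub>0 t \<le> ennreal (\<epsilon> / 2)" if t: "t \<in> T" for t
    proof -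
      have [measurable]: "X x\<^sub>0 t \<in> borel_measurable M" using X T t by auto
      have "continuous_on {0..} \<alpha>" using \<alpha> by (simp add: class_K_def)
      moreover have "continuous_on UNIV (\<lambda>r::real. max 0 r)" by (intro continuous_intros)
      ultimately have "continuous_on UNIV (\<lambda>r. \<alpha> (max 0 r))"
        by (rule continuous_on_compose2) auto
      then have "(\<lambda>r. \<alpha> (max 0 r)) \<in> borel_measurable borel"
        by (rule borel_measurable_continuous_onI)
      from measurable_compose[OF _ this, of "\<lambda>\<omega>. norm (X x\<^sub>0 t \<omega>)" M]
      have [measurable]: "(\<lambda>\<omega>. \<alpha> (norm (X x\<^sub>0 t \<omega>))) \<in> borel_measurable M" by simp
      have "I (\<lambda>r. r) x\<^sub>0 t \<le> (\<integral>\<^sup>+\<omega>. ennreal (\<epsilon> / 4) + ennreal c * ennreal (\<alpha> (norm (X x\<^sub>0 t \<omega>))) \<partial>M)"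
        unfolding I_def
      proof (rule nn_integral_mono)
        fix \<omega>
        have "norm (X x\<^sub>0 t \<omega>) \<le> \<epsilon> / 4 + c * \<alpha> (norm (X x\<^sub>0 t \<omega>))"
          unfolding c_def using \<epsilon> by (intro convex_linear_bound[OF \<alpha> conv]) auto
        then show "ennreal (norm (X x\<^sub>0 t \<omega>)) \<le> ennreal (\<epsilon> / 4) + ennreal c * ennreal (\<alpha> (norm (X x\<^sub>0 t \<omega>)))"
          using \<epsilon> c(1) \<alpha>_nonneg[of "norm (X x\<^sub>0 t \<omega>)"]
          by (simp add: ennreal_mult[symmetric] ennreal_plus[symmetric] ennreal_leI del: ennreal_plus)
      qed
      also have "\<dots> = ennreal (\<epsilon> / 4) * emeasure M (space M) + ennreal c * I \<alpha> x\<^sub>0 t"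
        unfolding I_def by (simp add: nn_integral_add nn_integral_cmult)
      also have "\<dots> \<le> ennreal (\<epsilon> / 4) * 1 + ennreal c * ennreal (\<alpha> (\<epsilon> / 4))"
        by (intro add_mono mult_left_mono M order.trans[OF SUP_upper[OF t] less_imp_le[OF less]]) simp_all
      also have "\<dots> = ennreal (\<epsilon> / 4 + c * \<alpha> (\<epsilon> / 4))"
        using c \<epsilon> \<alpha>_nonneg[of "\<epsilon> / 4"] by (simp add: ennreal_mult)
      also have "\<dots> = ennreal (\<epsilon> / 2)" unfolding c(2) by simp
      finally show ?thesis .
    qed
    then have "(SUP t\<in>T. I (\<lambda>r. r) x\<^sub>0 t) \<le> ennreal (\<epsilon> / 2)" by (rule SUP_least)
    also have "\<dots> < ennreal \<epsilon>" using \<epsilon> by (simp add: ennreal_less_iff)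
    finally show ?thesis .
  qed
  have gas1: "\<exists>\<delta>>0. \<forall>x\<^sub>0. norm x\<^sub>0 < \<delta> \<longrightarrow> (SUP t\<in>{0..}. I \<alpha> x\<^sub>0 t) < ennreal \<epsilon>" if "0 < \<epsilon>" for \<epsilon>
    using gas[unfolded gas_in_mean_of_def I_def[of \<alpha>, symmetric]] that by blast
  have gas2: "\<exists>T\<ge>0. \<forall>x\<^sub>0. norm x\<^sub>0 < r \<longrightarrow> (SUP t\<in>{T..}. I \<alpha> x\<^sub>0 t) < ennreal \<epsilon>"
    if "0 < r" "0 < \<epsilon>" for r \<epsilon>
    using gas[unfolded gas_in_mean_of_def I_def[of \<alpha>, symmetric]] that by blast
  show ?thesis
    unfolding gas_in_mean_def gas_in_mean_of_def I_def[of "\<lambda>r. r", symmetric]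
  proof (intro conjI allI impI)
    fix \<epsilon> :: real assume \<epsilon>: "0 < \<epsilon>"
    then have "0 < \<alpha> (\<epsilon> / 4)" using \<alpha>_pos by simp
    from gas1[OF this] show "\<exists>\<delta>>0. \<forall>x\<^sub>0. norm x\<^sub>0 < \<delta> \<longrightarrow> (SUP t\<in>{0..}. I (\<lambda>r. r) x\<^sub>0 t) < ennreal \<epsilon>"
      using transfer[OF \<epsilon> order.refl] by blast
  next
    fix r \<epsilon> :: real assume r: "0 < r" and \<epsilon>: "0 < \<epsilon>"
    then have "0 < \<alpha> (\<epsilon> / 4)" using \<alpha>_pos by simp
    from gas2[OF r this] obtain T where "T \<ge> 0"
      "\<And>x\<^sub>0. norm x\<^sub>0 < r \<Longrightarrow> (SUP t\<in>{T..}. I \<alpha> x\<^sub>0 t) < ennreal (\<alpha> (\<epsilon> / 4))" by blast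
    then show "\<exists>T\<ge>0. \<forall>x\<^sub>0. norm x\<^sub>0 < r \<longrightarrow> (SUP t\<in>{T..}. I (\<lambda>r. r) x\<^sub>0 t) < ennreal \<epsilon>"
      using transfer[OF \<epsilon>, of "{T..}"] by (intro exI[of _ T]) auto
  qed
qed

section \<open>Stability in the mean\<close>

theorem mainTheorem5:
  fixes M :: "'a measure" and F :: "real \<Rightarrow> 'a measure"
    and N :: nat and \<sigma> :: "real \<Rightarrow> 'a \<Rightarrow> nat"
    and f :: "nat \<Rightarrow> real ^ 'n \<Rightarrow> real ^ 'n"
    and V :: "nat \<Rightarrow> real ^ 'n \<Rightarrow> real"
    and \<alpha>\<^sub>1 \<alpha>\<^sub>2 :: "real \<Rightarrow> real"
    and lam_tilde lam_bar lam_o \<mu> :: real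
  assumes "N \<ge> 1"
    and "\<forall>p\<in>{1..N}. local_lipschitz (UNIV :: real set) UNIV (\<lambda>_. f p)"
    and "\<forall>p\<in>{1..N}. f p 0 = 0"
    and "\<forall>K :: (real \<times> (real ^ 'n)) set. compact K \<and> K \<subseteq> {0..} \<times> UNIV \<longrightarrow>
           (\<exists>m :: real \<Rightarrow> real. set_integrable lborel {0..} m \<and>
              (\<forall>(t, x)\<in>K. (SUP p\<in>{1..N}. norm (f p x)) \<le> m t))"
    and "prob_space M" and "complete_measure M"
    and "\<forall>t\<ge>0. \<sigma> t \<in> M \<rightarrow>\<^sub>M count_space {1..N}"
    and "\<forall>\<omega>\<in>space M. cadlag (\<lambda>t. \<sigma> t \<omega>)"
    and "\<forall>t\<ge>0. space (F t) = space M \<and>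
           sets (F t) = sets (natural_filtration_usual M (count_space {1..N}) \<sigma> t)"
    and "\<forall>p\<in>{1..N}. continuously_differentiable (V p) \<and> (\<forall>x. 0 \<le> V p x)"
    and "class_K_inf \<alpha>\<^sub>1" and "class_K_inf \<alpha>\<^sub>2"
    and "lam_tilde > 0" and "lam_bar > 0" and "lam_o > 0" and "\<mu> > 1"
    and "\<forall>x. \<forall>p\<in>{1..N}. \<alpha>\<^sub>1 (norm x) \<le> V p x \<and> V p x \<le> \<alpha>\<^sub>2 (norm x)"
    and "\<forall>x. \<forall>p\<in>{1..N}. frechet_derivative (V p) (at x) (f p x) \<le> - lam_o * V p x"
    and "\<forall>x. \<forall>p\<^sub>1\<in>{1..N}. \<forall>p\<^sub>2\<in>{1..N}. V p\<^sub>1 x \<le> \<mu> * V p\<^sub>2 x"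
    and "\<exists>m::nat. \<forall>k\<ge>m. \<forall>t\<ge>0.
           measure M {\<omega> \<in> space M. num_switches (\<lambda>u. \<sigma> u \<omega>) t = k}
             \<le> (lam_bar * t) ^ k * exp (- lam_tilde * t) / fact k"
    and "\<mu> < (lam_o + lam_tilde) / lam_bar"
  shows "\<exists>X. solution_process M f \<sigma> X \<and>
           (convex_on {0..} \<alpha>\<^sub>1 \<longrightarrow> gas_in_mean M X) \<and>
           gas_in_mean_of \<alpha>\<^sub>1 M X"
proof -
  define P where "P = {1..N}"
  interpret prob_space M by fact
  note a = assms
  have P: "finite P" by (simp add: P_def)
  have meas: "\<sigma> t \<in> M \<rightarrow>\<^sub>M count_space UNIV" if "0 \<le> t" for t
    by (rule measurable_compose[OF a(7)[rule_format, OF that], of "\<lambda>p. p"]) simp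
  have \<sigma>P: "\<sigma> t \<omega> \<in> P" if "\<omega> \<in> space M" "0 \<le> t" for \<omega> t
    using measurable_space[OF a(7)[rule_format, OF that(2)] that(1)] by (simp add: P_def)
  have cad: "cadlag (\<lambda>t. \<sigma> t \<omega>)" if "\<omega> \<in> space M" for \<omega> using a(8) that by blast
  have lip: "\<exists>L. L-lipschitz_on (cball 0 \<rho>) (f p)" if "p \<in> P" for p \<rho>
  proof -
    have "local_lipschitz {0::real} (cball 0 \<rho>) (\<lambda>_. f p)"
      by (rule local_lipschitz_subset[OF a(2)[rule_format]]) (use that in \<open>simp_all add: P_def\<close>)
    then show ?thesis
    proof (rule local_lipschitz_compact_implies_lipschitz)
      fix L assume "\<And>t. t \<in> {0::real} \<Longrightarrow> L-lipschitz_on (cball 0 \<rho>) (f p)"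
      then show ?thesis by blast
    qed simp_all
  qed
  have V: "V p differentiable (at x)" if "p \<in> P" for p x
  proof -
    have "continuously_differentiable (V p)" using a(10) that by (simp add: P_def)
    then obtain V' where "(V p has_derivative blinfun_apply (V' x)) (at x)"
      unfolding continuously_differentiable_def by blast
    then show ?thesis by (rule differentiableI)
  qed
  have V0: "0 \<le> V p x" if "p \<in> P" for p x using a(10) that by (simp add: P_def)
  have V\<alpha>: "\<alpha>\<^sub>1 (norm x) \<le> V p x" "V p x \<le> \<alpha>\<^sub>2 (norm x)" if "p \<in> P" for p x
    using a(17) that by (simp_all add: P_def)
  have K: "class_K \<alpha>\<^sub>1" "class_K \<alpha>\<^sub>2" "filterlim \<alpha>\<^sub>1 at_top at_top"
    using a(11,12) by (simp_all add: class_K_inf_def)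
  have decr: "frechet_derivative (V p) (at x) (f p x) \<le> - lam_o * V p x" if "p \<in> P" for p x
    using a(18) that by (simp add: P_def)
  have V\<mu>: "V p x \<le> \<mu> * V q x" if "p \<in> P" "q \<in> P" for p q x
    using a(19) that by (simp add: P_def)
  have "\<exists>X. solution_process M f \<sigma> X \<and>
      (\<forall>x\<^sub>0. \<forall>\<omega>\<in>space M. \<forall>t\<ge>0. V (\<sigma> t \<omega>) (X x\<^sub>0 t \<omega>)
        \<le> \<mu> ^ num_switches (\<lambda>u. \<sigma> u \<omega>) t * exp (- lam_o * t) * V (\<sigma> 0 \<omega>) x\<^sub>0)"
    by (rule solution_process_exists[where P = P, OF _ _ _ P _ _ _ _ K(3)])
      ((rule meas cad \<sigma>P lip V V0 V\<alpha>(1) decr V\<mu>; assumption) |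
        rule less_imp_le[OF a(15)] less_imp_le[OF a(16)])+
  then obtain X where X: "solution_process M f \<sigma> X"
    and X_bound: "\<And>x\<^sub>0 \<omega> t. \<omega> \<in> space M \<Longrightarrow> 0 \<le> t \<Longrightarrow> V (\<sigma> t \<omega>) (X x\<^sub>0 t \<omega>)
      \<le> \<mu> ^ num_switches (\<lambda>u. \<sigma> u \<omega>) t * exp (- lam_o * t) * V (\<sigma> 0 \<omega>) x\<^sub>0"
    by blast
  have X_meas: "X x\<^sub>0 t \<in> borel_measurable M" if "0 \<le> t" for x\<^sub>0 t
    using X that by (simp add: solution_process_def)
  obtain m where tail: "\<And>k t. m \<le> k \<Longrightarrow> 0 \<le> t \<Longrightarrow>
      measure M {\<omega> \<in> space M. num_switches (\<lambda>u. \<sigma> u \<omega>) t = k}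
        \<le> (lam_bar * t) ^ k * exp (- lam_tilde * t) / fact k"
    using a(20) by blast
  define S where "S = (\<Sum>k<m. \<mu> ^ k)"
  \<comment> \<open>The terms with fewer than \<open>m\<close> switches only decay at rate \<open>lam_o\<close>; the second entry is the rate
    of the exponential series.\<close>
  define \<kappa> where "\<kappa> = min lam_o (lam_o + lam_tilde - \<mu> * lam_bar)"
  have S: "0 \<le> S" using a(16) by (simp add: S_def sum_nonneg)
  have \<kappa>: "0 < \<kappa>" using a(14,15,21) by (simp add: \<kappa>_def field_simps)
  have bound: "(\<integral>\<^sup>+\<omega>. ennreal (\<alpha>\<^sub>1 (norm (X x\<^sub>0 t \<omega>))) \<partial>M)
      \<le> ennreal ((S + 1) * exp (- \<kappa> * t) * \<alpha>\<^sub>2 (norm x\<^sub>0))" if t: "0 \<le> t" for x\<^sub>0 t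
  proof -
    let ?N = "\<lambda>\<omega>. num_switches (\<lambda>u. \<sigma> u \<omega>) t"
    define b where "b = exp (- lam_o * t) * \<alpha>\<^sub>2 (norm x\<^sub>0)"
    have \<alpha>\<^sub>2: "0 \<le> \<alpha>\<^sub>2 (norm x\<^sub>0)" using V0[of 1 x\<^sub>0] V\<alpha>(2)[of 1 x\<^sub>0] a(1) by (simp add: P_def)
    have b: "0 \<le> b" using \<alpha>\<^sub>2 by (simp add: b_def)
    have N_meas: "?N \<in> M \<rightarrow>\<^sub>M count_space UNIV"
      by (rule measurable_num_switches[OF meas cad t])
    have "(\<integral>\<^sup>+\<omega>. ennreal (\<alpha>\<^sub>1 (norm (X x\<^sub>0 t \<omega>))) \<partial>M) \<le> (\<integral>\<^sup>+\<omega>. ennreal b * ennreal (\<mu> ^ ?N \<omega>) \<partial>M)"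
    proof (rule nn_integral_mono)
      fix \<omega> assume \<omega>: "\<omega> \<in> space M"
      have "\<alpha>\<^sub>1 (norm (X x\<^sub>0 t \<omega>)) \<le> V (\<sigma> t \<omega>) (X x\<^sub>0 t \<omega>)" by (rule V\<alpha>(1)[OF \<sigma>P[OF \<omega> t]])
      also have "\<dots> \<le> \<mu> ^ ?N \<omega> * exp (- lam_o * t) * V (\<sigma> 0 \<omega>) x\<^sub>0" by (rule X_bound[OF \<omega> t])
      also have "\<dots> \<le> \<mu> ^ ?N \<omega> * exp (- lam_o * t) * \<alpha>\<^sub>2 (norm x\<^sub>0)"
        using a(16) by (intro mult_left_mono V\<alpha>(2) \<sigma>P[OF \<omega>]) auto
      also have "\<dots> = b * \<mu> ^ ?N \<omega>" by (simp add: b_def)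
      finally have "ennreal (\<alpha>\<^sub>1 (norm (X x\<^sub>0 t \<omega>))) \<le> ennreal (b * \<mu> ^ ?N \<omega>)" by (rule ennreal_leI)
      then show "ennreal (\<alpha>\<^sub>1 (norm (X x\<^sub>0 t \<omega>))) \<le> ennreal b * ennreal (\<mu> ^ ?N \<omega>)"
        using b a(16) by (simp add: ennreal_mult)
    qed
    also have "\<dots> = ennreal b * (\<integral>\<^sup>+\<omega>. ennreal (\<mu> ^ ?N \<omega>) \<partial>M)"
      by (rule nn_integral_cmult) (rule measurable_compose[OF N_meas], simp)
    also have "(\<integral>\<^sup>+\<omega>. ennreal (\<mu> ^ ?N \<omega>) \<partial>M)
        \<le> ennreal (S + exp (- lam_tilde * t) * exp (\<mu> * (lam_bar * t)))"
      unfolding S_def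
      by (rule nn_integral_power_le[OF finite_measure_axioms _ N_meas])
        (use a(14,16) t tail in \<open>simp_all add: emeasure_space_1\<close>)
    also have "ennreal b * \<dots> = ennreal (b * (S + exp (- lam_tilde * t) * exp (\<mu> * (lam_bar * t))))"
      using b S by (simp add: ennreal_mult)
    also have "\<dots> \<le> ennreal ((S + 1) * exp (- \<kappa> * t) * \<alpha>\<^sub>2 (norm x\<^sub>0))"
    proof (rule ennreal_leI)
      have 1: "exp (- lam_o * t) \<le> exp (- \<kappa> * t)"
        using t by (simp add: \<kappa>_def mult_right_mono)
      have "exp (- lam_o * t) * (exp (- lam_tilde * t) * exp (\<mu> * (lam_bar * t))) =
          exp (- (lam_o + lam_tilde - \<mu> * lam_bar) * t)"
        unfolding exp_add[symmetric] by (simp add: algebra_simps)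
      also have "\<dots> \<le> exp (- \<kappa> * t)"
        using t by (simp only: exp_le_cancel_iff) (intro mult_right_mono, simp_all add: \<kappa>_def)
      finally have "exp (- lam_o * t) * (S + exp (- lam_tilde * t) * exp (\<mu> * (lam_bar * t)))
          \<le> exp (- \<kappa> * t) * S + exp (- \<kappa> * t)"
        unfolding distrib_left using 1 S by (intro add_mono mult_right_mono)
      then have "exp (- lam_o * t) * (S + exp (- lam_tilde * t) * exp (\<mu> * (lam_bar * t))) * \<alpha>\<^sub>2 (norm x\<^sub>0)
          \<le> (exp (- \<kappa> * t) * S + exp (- \<kappa> * t)) * \<alpha>\<^sub>2 (norm x\<^sub>0)"
        using \<alpha>\<^sub>2 by (rule mult_right_mono)
      then show "b * (S + exp (- lam_tilde * t) * exp (\<mu> * (lam_bar * t)))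
          \<le> (S + 1) * exp (- \<kappa> * t) * \<alpha>\<^sub>2 (norm x\<^sub>0)"
        by (simp add: b_def algebra_simps)
    qed
    finally show ?thesis by (simp add: mult_left_mono)
  qed
  have gas: "gas_in_mean_of \<alpha>\<^sub>1 M X"
    using S by (intro gas_in_mean_of_exponential_bound[OF K(2) _ \<kappa> bound]) auto
  moreover have "gas_in_mean M X" if "convex_on {0..} \<alpha>\<^sub>1"
    by (rule gas_in_mean_of_convex_imp_gas_in_mean[OF _ K(1) that X_meas gas])
      (simp_all add: emeasure_space_1)
  ultimately show ?thesis using X by blast
qed

end
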